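(* Let $S\ge2$, $L$, $m$, $n_B$ be positive integers, let $P_1,\dots,P_S$ be types of sequences in $\mathcal X^m$, let $\epsilon\in(0,1)$, $\tau\in(0,\epsilon)$, $\zeta>0$, and let $h_\ell:\mathcal X^{(\ell-1)m}\times\mathcal Y^{(\ell-1)m}\times\mathcal Y^{(\ell-1)m}\to\{1,\dots,S\}$, $\ell=1,\dots,L$, be arbitrary mappings. Let $\mathbb x$ be any element of $$\mathbb F=\{\mathbb x\in\mathcal X^{SLm}:\ \mathbb x_\ell(s)\text{ has type }P_s\ \ \forall s\in\{1,\dots,S\},\ \forall \ell\in\{1,\dots,L\}\}.$$ Then $$\log M^*_{\mathrm f}\big(Lm+n_B,\ \epsilon+\epsilon^*(n_B,S^L)\big)\ \ge\ \sup\Big\{\gamma:\ \max_{k}\mathbb P\big[\imath_k(\mathbb x^L(B^L);\mathbb Y_k^L(B^L))\le\gamma\big]<\epsilon-\tau-e^{-\zeta}\Big\}+\log\frac\tau2-SL|\mathcal X|\log(1+m)-L\log S-\zeta,$$ where the probability is under the distribution $\mathbb P_{\mathbb Y_1,\mathbb Y_2,B^L}$ defined below.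
   Context: Setting (CM-DMBC): finite alphabets $\mathcal X=\{1,\dots,N\}$, $\mathcal Y$; transition matrices $W_1,W_2$; given input $x$ the two outputs are $(y_1,y_2)$ with probability $W_1(y_1|x)W_2(y_2|x)$, memoryless. $\imath_{P,W_k}(x;y)=\log\frac{W_k(y|x)}{PW_k(y)}$ with $PW_k(y)=\sum_xP(x)W_k(y|x)$. An $(n,M,\epsilon)$-FLF code: encoders $f_i:\{1,\dots,M\}\times\mathcal Y^{i-1}\times\mathcal Y^{i-1}\to\mathcal X$ (possibly randomized), $X_i=f_i(J,Y_1^{i-1},Y_2^{i-1})$ with $J$ uniform on $\{1,\dots,M\}$; decoders $g_k:\mathcal Y^n\to\{1,\dots,M\}$ with $\mathbb P[g_k(Y_k^n)\ne J]\le\epsilon$, $k=1,2$. $M^*_{\mathrm f}(n,\epsilon)$ is the largest $M$ for which an $(n,M,\epsilon)$-FLF code exists. $\epsilon^*(n_B,S^L)$ is the smallest $\epsilon$ such that there exists a fixed-length no-feedback code for the CM-DMBC of blocklength $n_B$ with $S^L$ messages (encoder a map from messages to $\mathcal X^{n_B}$, decoders $g_k:\mathcal Y^{n_B}\to$ messages) with $\mathbb P[g_k(Y_k^{n_B})\ne J]\le\epsilon$ for $k=1,2$. Indexing: elements $\mathbb x\in\mathcal X^{SLm}$ are written $\mathbb x=(\mathbb x_1(1),\dots,\mathbb x_1(S),\dots,\mathbb x_L(1),\dots,\mathbb x_L(S))$ with $\mathbb x_\ell(s)=(\mathbb x_{\ell,1}(s),\dots,\mathbb x_{\ell,m}(s))\in\mathcal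 X^m$; for $b^\ell\in\{1,\dots,S\}^\ell$, $\mathbb x^\ell(b^\ell)=(\mathbb x_1(b_1),\dots,\mathbb x_\ell(b_\ell))$; the same indexing is used for elements $\mathbb y_k\in\mathcal Y^{SLm}$. The distribution of $(\mathbb Y_1,\mathbb Y_2,B^L)\in\mathcal Y^{SLm}\times\mathcal Y^{SLm}\times\{1,\dots,S\}^L$ is $$\mathbb P_{\mathbb Y_1,\mathbb Y_2,B^L}(\mathbb y_1,\mathbb y_2,b^L)=\prod_{\ell=1}^L\Big(\prod_{s=1}^S\prod_{k=1}^2W_k^m(\mathbb y_{k,\ell}(s)|\mathbb x_\ell(s))\Big)\mathbb 1\{h_\ell(\mathbb x^{\ell-1}(b^{\ell-1}),\mathbb y_1^{\ell-1}(b^{\ell-1}),\mathbb y_2^{\ell-1}(b^{\ell-1}))=b_\ell\},$$ where $W_k^m$ is the product channel. Finally $\imath_k(\mathbb x_\ell(b_\ell);\mathbb y_{k,\ell}(b_\ell))=\sum_{i=1}^m\imath_{P_{b_\ell},W_k}(\mathbb x_{\ell,i}(b_\ell);\mathbb y_{k,\ell,i}(b_\ell))$ and $\imath_k(\mathbb x^L(b^L);\mathbb y_k^L(b^L))=\sum_{\ell=1}^L\imath_k(\mathbb x_\ell(b_\ell);\mathbb y_{k,\ell}(b_\ell))$. Logarithms are natural. *)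

theory Defs
  imports "HOL-Probability.Probability"
begin

(* Channels are written W x y = W(y|x); alphabets are finite types 'x, 'y.
   Logarithms are natural (ln). *)

definition stochastic :: "('x::finite \<Rightarrow> 'y::finite \<Rightarrow> real) \<Rightarrow> bool" where
  "stochastic W \<longleftrightarrow> (\<forall>x y. 0 \<le> W x y) \<and> (\<forall>x. (\<Sum>y\<in>UNIV. W x y) = 1)"

definition prodW :: "('x \<Rightarrow> 'y \<Rightarrow> real) \<Rightarrow> 'x list \<Rightarrow> 'y list \<Rightarrow> real" where
  "prodW W xs ys = (\<Prod>i<length xs. W (xs ! i) (ys ! i))"

(* A deterministic feedback encoder: enc i j ys1 ys2 = f_i(j, y1^{i-1}, y2^{i-1}), i = 1..n.
   Probability of output sequences (y1^n, y2^n) when message j is sent. *)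
definition flf_prob ::
  "('x \<Rightarrow> 'y \<Rightarrow> real) \<Rightarrow> ('x \<Rightarrow> 'y \<Rightarrow> real) \<Rightarrow> nat \<Rightarrow>
   (nat \<Rightarrow> nat \<Rightarrow> 'y list \<Rightarrow> 'y list \<Rightarrow> 'x) \<Rightarrow> nat \<Rightarrow> 'y list \<Rightarrow> 'y list \<Rightarrow> real" where
  "flf_prob W1 W2 n enc j y1 y2 =
     (\<Prod>i\<in>{1..n}. W1 (enc i j (take (i - 1) y1) (take (i - 1) y2)) (y1 ! (i - 1))
                 * W2 (enc i j (take (i - 1) y1) (take (i - 1) y2)) (y2 ! (i - 1)))"

definition flf_err ::
  "('x::finite \<Rightarrow> 'y::finite \<Rightarrow> real) \<Rightarrow> ('x \<Rightarrow> 'y \<Rightarrow> real) \<Rightarrow> nat \<Rightarrow> nat \<Rightarrow>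
   (nat \<Rightarrow> nat \<Rightarrow> 'y list \<Rightarrow> 'y list \<Rightarrow> 'x) \<Rightarrow> nat \<Rightarrow> ('y list \<Rightarrow> nat) \<Rightarrow> real" where
  "flf_err W1 W2 n M enc k g =
     (1 / real M) * (\<Sum>j\<in>{1..M}. \<Sum>y1\<in>{ys. length ys = n}. \<Sum>y2\<in>{ys. length ys = n}.
        flf_prob W1 W2 n enc j y1 y2 * (if g (if k = 1 then y1 else y2) \<noteq> j then 1 else 0))"

(* (n,M,eps)-FLF code: a possibly randomized encoder, i.e. a probability distribution Q over
   deterministic feedback encoders, and deterministic decoders g1, g2 *)
definition flf_code ::
  "('x::finite \<Rightarrow> 'y::finite \<Rightarrow> real) \<Rightarrow> ('x \<Rightarrow> 'y \<Rightarrow> real) \<Rightarrow> nat \<Rightarrow> nat \<Rightarrow> real \<Rightarrow>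
   (nat \<Rightarrow> nat \<Rightarrow> 'y list \<Rightarrow> 'y list \<Rightarrow> 'x) pmf \<Rightarrow> ('y list \<Rightarrow> nat) \<Rightarrow> ('y list \<Rightarrow> nat) \<Rightarrow> bool" where
  "flf_code W1 W2 n M eps Q g1 g2 \<longleftrightarrow> M \<ge> 1 \<and>
     measure_pmf.expectation Q (\<lambda>enc. flf_err W1 W2 n M enc 1 g1) \<le> eps \<and>
     measure_pmf.expectation Q (\<lambda>enc. flf_err W1 W2 n M enc 2 g2) \<le> eps"

definition Mstar_f :: "('x::finite \<Rightarrow> 'y::finite \<Rightarrow> real) \<Rightarrow> ('x \<Rightarrow> 'y \<Rightarrow> real) \<Rightarrow> nat \<Rightarrow> real \<Rightarrow> ereal" where
  "Mstar_f W1 W2 n eps = Sup {ereal (real M) | M. \<exists>Q g1 g2. flf_code W1 W2 n M eps Q g1 g2}"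

definition ln_ereal :: "ereal \<Rightarrow> ereal" where
  "ln_ereal z = (if z = \<infinity> then \<infinity> else if z > 0 then ereal (ln (real_of_ereal z)) else -\<infinity>)"

definition nf_err ::
  "('x::finite \<Rightarrow> 'y::finite \<Rightarrow> real) \<Rightarrow> nat \<Rightarrow> nat \<Rightarrow> (nat \<Rightarrow> 'x list) \<Rightarrow> ('y list \<Rightarrow> nat) \<Rightarrow> real" where
  "nf_err W n M enc g =
     (1 / real M) * (\<Sum>j\<in>{1..M}. \<Sum>ys\<in>{ys. length ys = n}.
        prodW W (enc j) ys * (if g ys \<noteq> j then 1 else 0))"

definition eps_star :: "('x::finite \<Rightarrow> 'y::finite \<Rightarrow> real) \<Rightarrow> ('x \<Rightarrow> 'y \<Rightarrow> real) \<Rightarrow> nat \<Rightarrow> nat \<Rightarrow> real" where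
  "eps_star W1 W2 n M = Inf {e. \<exists>enc g1 g2. (\<forall>j\<in>{1..M}. length (enc j) = n) \<and>
       nf_err W1 n M enc g1 \<le> e \<and> nf_err W2 n M enc g2 \<le> e}"

definition has_type :: "nat \<Rightarrow> 'x list \<Rightarrow> ('x \<Rightarrow> real) \<Rightarrow> bool" where
  "has_type m xs P \<longleftrightarrow> length xs = m \<and> (\<forall>a. P a = real (count_list xs a) / real m)"

definition is_type :: "nat \<Rightarrow> ('x \<Rightarrow> real) \<Rightarrow> bool" where
  "is_type m P \<longleftrightarrow> (\<exists>xs. has_type m xs P)"

definition in_F :: "nat \<Rightarrow> nat \<Rightarrow> nat \<Rightarrow> (nat \<Rightarrow> 'x \<Rightarrow> real) \<Rightarrow> (nat \<Rightarrow> nat \<Rightarrow> 'x list) \<Rightarrow> bool" where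
  "in_F S L m P xx \<longleftrightarrow> (\<forall>s\<in>{1..S}. \<forall>l\<in>{1..L}. has_type m (xx l s) (P s))"

definition xprefix :: "(nat \<Rightarrow> nat \<Rightarrow> 'x list) \<Rightarrow> nat \<Rightarrow> (nat \<Rightarrow> nat) \<Rightarrow> 'x list" where
  "xprefix xx l b = concat (map (\<lambda>j. xx j (b j)) [1..<l])"

definition yprefix :: "(nat \<times> nat \<Rightarrow> 'y list) \<Rightarrow> nat \<Rightarrow> (nat \<Rightarrow> nat) \<Rightarrow> 'y list" where
  "yprefix yy l b = concat (map (\<lambda>j. yy (j, b j)) [1..<l])"

(* the set \<Y>^{SLm}: yy (l,s) = \<bbby>_l(s) \<in> Y^m *)
definition Yspace :: "nat \<Rightarrow> nat \<Rightarrow> nat \<Rightarrow> (nat \<times> nat \<Rightarrow> 'y list) set" where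
  "Yspace S L m = PiE ({1..L} \<times> {1..S}) (\<lambda>_. {ys. length ys = m})"

definition Bspace :: "nat \<Rightarrow> nat \<Rightarrow> (nat \<Rightarrow> nat) set" where
  "Bspace S L = PiE {1..L} (\<lambda>_. {1..S})"

definition joint_pmf ::
  "('x \<Rightarrow> 'y \<Rightarrow> real) \<Rightarrow> ('x \<Rightarrow> 'y \<Rightarrow> real) \<Rightarrow> nat \<Rightarrow> nat \<Rightarrow>
   (nat \<Rightarrow> 'x list \<Rightarrow> 'y list \<Rightarrow> 'y list \<Rightarrow> nat) \<Rightarrow> (nat \<Rightarrow> nat \<Rightarrow> 'x list) \<Rightarrow>
   (nat \<times> nat \<Rightarrow> 'y list) \<Rightarrow> (nat \<times> nat \<Rightarrow> 'y list) \<Rightarrow> (nat \<Rightarrow> nat) \<Rightarrow> real" where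
  "joint_pmf W1 W2 S L h xx yy1 yy2 b =
     (\<Prod>l\<in>{1..L}. (\<Prod>s\<in>{1..S}. prodW W1 (xx l s) (yy1 (l, s)) * prodW W2 (xx l s) (yy2 (l, s)))
        * (if h l (xprefix xx l b) (yprefix yy1 l b) (yprefix yy2 l b) = b l then 1 else 0))"

definition idens :: "('x::finite \<Rightarrow> real) \<Rightarrow> ('x \<Rightarrow> 'y \<Rightarrow> real) \<Rightarrow> 'x \<Rightarrow> 'y \<Rightarrow> real" where
  "idens P W x y = ln (W x y / (\<Sum>x'\<in>UNIV. P x' * W x' y))"

definition idens_total ::
  "nat \<Rightarrow> nat \<Rightarrow> (nat \<Rightarrow> 'x::finite \<Rightarrow> real) \<Rightarrow> ('x \<Rightarrow> 'y \<Rightarrow> real) \<Rightarrow>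
   (nat \<Rightarrow> nat \<Rightarrow> 'x list) \<Rightarrow> (nat \<times> nat \<Rightarrow> 'y list) \<Rightarrow> (nat \<Rightarrow> nat) \<Rightarrow> real" where
  "idens_total L m P W xx yy b =
     (\<Sum>l\<in>{1..L}. \<Sum>i<m. idens (P (b l)) W (xx l (b l) ! i) (yy (l, b l) ! i))"

definition tail_prob ::
  "('x::finite \<Rightarrow> 'y::finite \<Rightarrow> real) \<Rightarrow> ('x \<Rightarrow> 'y \<Rightarrow> real) \<Rightarrow> nat \<Rightarrow> nat \<Rightarrow> nat \<Rightarrow>
   (nat \<Rightarrow> 'x \<Rightarrow> real) \<Rightarrow> (nat \<Rightarrow> 'x list \<Rightarrow> 'y list \<Rightarrow> 'y list \<Rightarrow> nat) \<Rightarrow>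
   (nat \<Rightarrow> nat \<Rightarrow> 'x list) \<Rightarrow> nat \<Rightarrow> real \<Rightarrow> real" where
  "tail_prob W1 W2 S L m P h xx k \<gamma> =
     (\<Sum>yy1\<in>Yspace S L m. \<Sum>yy2\<in>Yspace S L m. \<Sum>b\<in>Bspace S L.
        joint_pmf W1 W2 S L h xx yy1 yy2 b *
        (if (if k = 1 then idens_total L m P W1 xx yy1 b else idens_total L m P W2 xx yy2 b) \<le> \<gamma>
         then 1 else 0))"

end

theory Submission
  imports Defs "HOL-Combinatorics.Multiset_Permutations"
begin

text \<open>
  Permuting the blocks of the given array \<open>xx\<close> yields, for every tuple of permutations, a feedback
  scheme whose outputs (with the permutations undone) have the same law. These schemes form the
  codebook of a maximal coding argument in the style of Feinstein: codewords are added as long as both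
  receivers decode the new one with error at most \<open>\<epsilon>\<close>. A receiver accepts a codeword if, for some
  path \<open>b\<close>, the likelihood of its output exceeds a threshold times the output law \<open>G\<close> of a random
  codeword. Up to a factor \<open>(1 + m) ^ (L * |X|)\<close> from averaging over type classes and a factor
  \<open>S ^ L\<close> from the choice of the path, \<open>G\<close> can be replaced by the memoryless output law that defines
  the information density, except with probability \<open>exp (- \<zeta>)\<close>. Testing all paths costs a second
  factor \<open>S ^ L\<close>, which \<open>(1 + m) ^ ((S - 1) * L * |X|)\<close> absorbs. Hence the receivers never need
  to be told the path, and the last \<open>nB\<close> channel uses are ignored.
\<close>

subsection \<open>Type classes\<close>

text \<open>The tests use \<open>G\<close> because of a mismatch of paths. Comparing
  \<open>w k b\<close> with \<open>Q k b\<close> looks more natural, and \<open>Gb_le\<close> would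
  control a wrong codeword if the path under test were the one actually taken. But a wrong codeword
  may pass its test along a path \<open>b'\<close> other than the path \<open>b\<close> of the
  transmitted one; \<open>Q k b\<close> and \<open>Q k b'\<close> are then products of different
  output distributions and neither need bound the other. \<open>G\<close> belongs to no path:
  against it, false acceptance is a plain change of measure with total mass 1 per tested path. The
  price is the event that \<open>G\<close> is too large compared with \<open>Q\<close>, but that is
  needed only along the true path, where \<open>Gb_le\<close> does apply.

  Permutations of one array replace independent random words because the bound concerns a single
  \<open>xx\<close>: every codeword then obeys the same error bound, in terms of
  \<open>tail_prob\<close> of that array, whatever the maps \<open>h\<close> do.\<close>

lemma finite_lists_length_eq_UNIV: "finite {xs :: 'a::finite list. length xs = n}"
  using finite_lists_length_eq[of "UNIV :: 'a set" n] by simp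

lemma sum_lists_prod:
  fixes f :: "nat \<Rightarrow> 'a::finite \<Rightarrow> real"
  shows "(\<Sum>xs\<in>{xs. length xs = n}. \<Prod>i<n. f i (xs ! i)) = (\<Prod>i<n. \<Sum>a\<in>UNIV. f i a)"
proof (induction n arbitrary: f)
  case 0
  then show ?case by simp
next
  case (Suc n)
  have "{xs :: 'a list. length xs = Suc n} = (\<lambda>(a, xs). a # xs) ` (UNIV \<times> {xs. length xs = n})"
    by (auto simp: length_Suc_conv image_iff)
  moreover have "inj_on (\<lambda>(a, xs). a # xs) (UNIV \<times> {xs :: 'a list. length xs = n})"
    by (auto simp: inj_on_def)
  ultimately have "(\<Sum>xs\<in>{xs. length xs = Suc n}. \<Prod>i<Suc n. f i (xs ! i))
      = (\<Sum>(a, xs)\<in>UNIV \<times> {xs. length xs = n}. f 0 a * (\<Prod>i<n. f (Suc i) (xs ! i)))"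
    by (simp add: sum.reindex prod.lessThan_Suc_shift case_prod_unfold del: prod.lessThan_Suc)
  also have "\<dots> = (\<Sum>a\<in>UNIV. f 0 a) * (\<Prod>i<n. \<Sum>a\<in>UNIV. f (Suc i) a)"
    by (simp add: Suc.IH[of "\<lambda>i. f (Suc i)", symmetric] sum_product sum.cartesian_product)
  finally show ?case by (simp add: prod.lessThan_Suc_shift del: prod.lessThan_Suc)
qed

lemma sum_prodW_eq_1:
  assumes "stochastic W" "length xs = n"
  shows "(\<Sum>ys\<in>{ys. length ys = n}. prodW W xs ys) = 1"
  using assms sum_lists_prod[of "\<lambda>i. W (xs ! i)" n] by (simp add: prodW_def stochastic_def)

lemma prodW_nonneg: "stochastic W \<Longrightarrow> 0 \<le> prodW W xs ys"
  by (auto simp: prodW_def stochastic_def intro!: prod_nonneg)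

lemma prod_nth_eq_prod_power_count:
  fixes f :: "'a::finite \<Rightarrow> real"
  shows "(\<Prod>i<length xs. f (xs ! i)) = (\<Prod>a\<in>UNIV. f a ^ count (mset xs) a)"
proof (induction xs)
  case (Cons x xs)
  have "(\<Prod>a\<in>UNIV. f a ^ count (mset (x # xs)) a)
      = (\<Prod>a\<in>UNIV. (if a = x then f a else 1) * f a ^ count (mset xs) a)"
    by (intro prod.cong) auto
  also have "\<dots> = f x * (\<Prod>a\<in>UNIV. f a ^ count (mset xs) a)"
    by (simp add: prod.distrib)
  finally show ?case by (simp add: prod.lessThan_Suc_shift Cons del: prod.lessThan_Suc)
qed simp

text \<open>For \<open>l \<ge> k\<close> the quotient l!/k! consists of l-k factors that are at
  least k; for \<open>l < k\<close> the quotient k!/l! consists of k-l factors that are at most k.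
  Both cases are written without division.\<close>

lemma power_mult_fact_le:
  "(k::nat) ^ l * fact k \<le> k ^ k * fact l"
proof (cases "k \<le> l")
  case True
  then obtain d where d: "l = k + d" using le_Suc_ex by blast
  have "k ^ d * fact k \<le> fact (k + d)"
  proof (induction d)
    case (Suc d)
    have "k ^ Suc d * fact k = k * (k ^ d * fact k)" by simp
    also have "\<dots> \<le> (Suc (k + d)) * fact (k + d)" by (intro mult_mono Suc) auto
    finally show ?case by simp
  qed simp
  then show ?thesis using d by (simp add: power_add)
next
  case False
  then obtain d where d: "k = l + d" by (metis le_Suc_ex nle_le)
  have "fact (l + e) \<le> (l + e) ^ e * fact l" for e
  proof (induction e)
    case (Suc e)
    have "fact (l + Suc e) = (l + Suc e) * fact (l + e)" by simp
    also have "\<dots> \<le> (l + Suc e) * ((l + e) ^ e * fact l)" by (intro mult_mono Suc) auto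
    also have "\<dots> \<le> (l + Suc e) * ((l + Suc e) ^ e * fact l)"
      by (intro mult_mono power_mono) auto
    finally show ?case by (simp only: power_Suc mult.assoc)
  qed simp
  from this[of d] have "fact k \<le> k ^ d * fact l" using d by simp
  then have "k ^ l * fact k \<le> k ^ l * (k ^ d * fact l)" by (rule mult_left_mono) simp
  then show ?thesis using d by (simp add: power_add mult.assoc)
qed

lemma prod_fact_count_UNIV:
  fixes A :: "'a::finite multiset"
  shows "(\<Prod>x\<in>set_mset A. fact (count A x) :: nat) = (\<Prod>x\<in>UNIV. fact (count A x))"
  by (rule prod.mono_neutral_left) (auto simp: not_in_iff)

lemma card_permutations_mult_prod_fact:
  fixes A :: "'a::finite multiset"
  shows "real (card (permutations_of_multiset A)) * (\<Prod>x\<in>UNIV. fact (count A x)) = fact (size A)"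
  using arg_cong[OF card_permutations_of_multiset_aux[of A], of real]
  by (simp add: prod_fact_count_UNIV)

text \<open>By the multinomial formula both sides share the factor m!/m^m, and the rest compares
  letter by letter through \<open>power_mult_fact_le\<close>. In words: words drawn i.i.d. from a
  type hit the class of that type at least as often as any other class.\<close>

lemma type_class_prob_max:
  fixes A B :: "'a::finite multiset"
  assumes "size A = m" "size B = m"
  shows "real (card (permutations_of_multiset B)) * (\<Prod>a\<in>UNIV. (real (count A a) / m) ^ count B a)
       \<le> real (card (permutations_of_multiset A)) * (\<Prod>a\<in>UNIV. (real (count A a) / m) ^ count A a)"
proof -
  have pow: "(\<Prod>a\<in>UNIV. (real (count A a) / m) ^ count C a)
      = (\<Prod>a\<in>UNIV. real (count A a) ^ count C a) / real m ^ m" if "size C = m" for C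
  proof -
    have "(\<Sum>a\<in>UNIV. count C a) = m"
      using that sum.mono_neutral_left[of UNIV "set_mset C" "count C"]
      by (simp add: size_multiset_overloaded_eq not_in_iff)
    then show ?thesis
      by (simp add: power_divide prod_dividef power_sum[symmetric])
  qed
  have card: "real (card (permutations_of_multiset C)) = fact m / (\<Prod>x\<in>UNIV. fact (count C x))"
    if "size C = m" for C :: "'a multiset"
    using card_permutations_mult_prod_fact[of C] that by (simp add: field_simps)
  have "(\<Prod>a\<in>UNIV. real (count A a) ^ count B a) * (\<Prod>a\<in>UNIV. fact (count A a))
      \<le> (\<Prod>a\<in>UNIV. real (count A a) ^ count A a) * (\<Prod>a\<in>UNIV. fact (count B a))"
    unfolding prod.distrib[symmetric]
  proof (intro prod_mono conjI)
    fix a :: 'a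
    show "real (count A a) ^ count B a * fact (count A a) \<le> real (count A a) ^ count A a * fact (count B a)"
      using power_mult_fact_le[of "count A a" "count B a"]
      by (metis (mono_tags) of_nat_fact of_nat_le_iff of_nat_mult of_nat_power)
  qed simp
  moreover have "0 < (\<Prod>a\<in>UNIV. fact (count C a) :: real)" for C :: "'a multiset"
    by (intro prod_pos) simp
  ultimately have "(\<Prod>a\<in>UNIV. real (count A a) ^ count B a) / (\<Prod>a\<in>UNIV. fact (count B a))
      \<le> (\<Prod>a\<in>UNIV. real (count A a) ^ count A a) / (\<Prod>a\<in>UNIV. fact (count A a))"
    by (simp add: divide_simps)
  from mult_left_mono[OF this, of "fact m / real m ^ m"] show ?thesis
    by (simp add: pow assms card mult_ac)
qed

text \<open>Pigeonhole: the probabilities of all type classes add up to 1, the class of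
  \<open>A\<close> has the largest one, and a type is determined by its counts, a map from the
  alphabet to \<open>{..m}\<close>.\<close>

lemma type_class_prob_ge:
  fixes A :: "'a::finite multiset"
  assumes "size A = m" "m \<ge> 1"
  shows "1 \<le> (1 + real m) ^ CARD('a) *
     (real (card (permutations_of_multiset A)) * (\<Prod>a\<in>UNIV. (real (count A a) / m) ^ count A a))"
proof -
  define p where "p a = real (count A a) / m" for a
  define X where "X = {xs :: 'a list. length xs = m}"
  define Ty where "Ty = {B :: 'a multiset. size B = m}"
  have cnt: "(\<Sum>a\<in>UNIV. count A a) = m"
    using assms sum.mono_neutral_left[of UNIV "set_mset A" "count A"]
    by (simp add: size_multiset_overloaded_eq not_in_iff)
  have "(\<Sum>a\<in>UNIV. p a) = 1"
    using assms cnt by (simp add: p_def sum_divide_distrib[symmetric] flip: of_nat_sum)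
  then have one: "1 = (\<Sum>xs\<in>X. \<Prod>i<m. p (xs ! i))"
    using sum_lists_prod[of "\<lambda>_. p" m] by (simp add: X_def)
  have inj: "inj_on count Ty" by (auto simp: inj_on_def multiset_eq_iff)
  have "count ` Ty \<subseteq> PiE UNIV (\<lambda>_. {..m})"
    using count_le_size by (fastforce simp: Ty_def PiE_def Pi_def)
  from card_mono[OF _ this] have "card (count ` Ty) \<le> (1 + m) ^ CARD('a)" 
    and finc: "finite (count ` Ty)"
    using finite_subset[OF \<open>count ` Ty \<subseteq> _\<close>] by (auto simp: card_PiE finite_PiE)
  then have cardTy: "card Ty \<le> (1 + m) ^ CARD('a)" and finTy: "finite Ty"
    using inj by (auto simp: card_image finite_image_iff)
  have "(\<Sum>xs\<in>X. \<Prod>i<m. p (xs ! i)) = (\<Sum>B\<in>Ty. \<Sum>xs\<in>{xs\<in>X. mset xs = B}. \<Prod>i<m. p (xs ! i))"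
    by (rule sum.group[symmetric]) (auto simp: X_def Ty_def finite_lists_length_eq_UNIV finTy[unfolded Ty_def])
  also have "\<dots> = (\<Sum>B\<in>Ty. real (card (permutations_of_multiset B)) * (\<Prod>a\<in>UNIV. p a ^ count B a))"
  proof (intro sum.cong refl)
    fix B assume B: "B \<in> Ty"
    have eq: "{xs\<in>X. mset xs = B} = permutations_of_multiset B"
      using B by (auto simp: X_def Ty_def permutations_of_multiset_def)
    have "(\<Prod>i<m. p (xs ! i)) = (\<Prod>a\<in>UNIV. p a ^ count B a)" if "xs \<in> permutations_of_multiset B" for xs
      using prod_nth_eq_prod_power_count[of p xs] that B
      by (auto simp: permutations_of_multiset_def Ty_def)
    then show "(\<Sum>xs\<in>{xs\<in>X. mset xs = B}. \<Prod>i<m. p (xs ! i))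
        = real (card (permutations_of_multiset B)) * (\<Prod>a\<in>UNIV. p a ^ count B a)"
      unfolding eq by simp
  qed
  also have "\<dots> \<le> (\<Sum>B\<in>Ty. real (card (permutations_of_multiset A)) * (\<Prod>a\<in>UNIV. p a ^ count A a))"
    unfolding p_def by (intro sum_mono type_class_prob_max) (auto simp: Ty_def assms)
  also have "\<dots> = real (card Ty) * (real (card (permutations_of_multiset A)) * (\<Prod>a\<in>UNIV. p a ^ count A a))"
    by simp
  also have "\<dots> \<le> (1 + real m) ^ CARD('a) * (real (card (permutations_of_multiset A)) * (\<Prod>a\<in>UNIV. p a ^ count A a))"
    using cardTy of_nat_mono[OF cardTy, where 'a=real]
    by (intro mult_right_mono mult_nonneg_nonneg prod_nonneg) (auto simp: p_def)
  finally show ?thesis using one by (simp add: p_def)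
qed

lemma prodW_permute_both:
  assumes "p permutes {..<n}" "length xs = n" "length ys = n"
  shows "prodW W (permute_list p xs) (permute_list p ys) = prodW W xs ys"
proof -
  have "prodW W (permute_list p xs) (permute_list p ys) = (\<Prod>i<n. W (xs ! p i) (ys ! p i))"
    using assms by (simp add: prodW_def permute_list_nth)
  also have "\<dots> = prodW W xs ys"
    using prod.permute[OF assms(1), of "\<lambda>i. W (xs ! i) (ys ! i)"] assms by (simp add: prodW_def o_def)
  finally show ?thesis .
qed

text \<open>The sum over the type class and the sum over permutations
  of one representative are compared by double counting.\<close>

lemma sum_permutes_prodW_le:
  fixes W :: "'x::finite \<Rightarrow> 'y \<Rightarrow> real"
  assumes W: "\<And>x y. 0 \<le> W x y" and P: "has_type m xs P" and m: "m \<ge> 1" and ys: "length ys = m"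
  shows "(\<Sum>p\<in>{p. p permutes {..<m}}. prodW W xs (permute_list p ys))
    \<le> fact m * (1 + real m) ^ CARD('x) * (\<Prod>i<m. \<Sum>x\<in>UNIV. P x * W x (ys ! i))"
proof -
  define A where "A = mset xs"
  define T where "T = permutations_of_multiset A"
  define Pe where "Pe = {p. p permutes {..<m}}"
  define q where "q = (\<Prod>a\<in>UNIV. P a ^ count A a)"
  define avg where "avg = (\<Sum>p\<in>Pe. prodW W xs (permute_list p ys))"
  have lx: "length xs = m" and Pa: "P a = real (count A a) / m" for a
    using P by (auto simp: has_type_def A_def count_mset)
  have P0: "0 \<le> P a" for a by (simp add: Pa)
  have lT: "length x = m" if "x \<in> T" for x
    using that lx mset_eq_length by (force simp: T_def A_def permutations_of_multiset_def)
  \<comment> \<open>Another representative differs from \<open>xs\<close> by a permutation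
    \<open>r\<close>, which is absorbed into the summation over \<open>p\<close>.\<close>
  have each: "(\<Sum>p\<in>Pe. prodW W x (permute_list p ys)) = avg" if "x \<in> T" for x
  proof -
    from that have "mset x = mset xs" by (simp add: T_def A_def permutations_of_multiset_def)
    then obtain r where r: "r permutes {..<m}" "permute_list r xs = x"
      using mset_eq_permutation lx by metis
    have "avg = (\<Sum>p\<in>Pe. prodW W x (permute_list r (permute_list p ys)))"
      unfolding avg_def using r lx ys by (intro sum.cong refl) (auto simp: prodW_permute_both[of r m])
    also have "\<dots> = (\<Sum>p\<in>Pe. prodW W x (permute_list (p \<circ> r) ys))"
      using r ys by (simp add: permute_list_compose)
    also have "\<dots> = (\<Sum>p\<in>Pe. prodW W x (permute_list p ys))"
      by (rule sum.reindex_bij_witness[of _ "\<lambda>p. p \<circ> inv r" "\<lambda>p. p \<circ> r"])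
        (use r in \<open>auto simp: Pe_def permutes_compose permutes_inv o_assoc[symmetric] permutes_inv_o\<close>)
    finally show ?thesis by simp
  qed
  have "fact m * (\<Sum>x\<in>T. prodW W x ys) = (\<Sum>p\<in>Pe. \<Sum>x\<in>T. prodW W x ys)"
    by (simp add: Pe_def card_permutations)
  \<comment> \<open>Permuting input and output together changes no likelihood and maps the type
    class onto itself.\<close>
  also have "\<dots> = (\<Sum>p\<in>Pe. \<Sum>x\<in>T. prodW W x (permute_list p ys))"
  proof (rule sum.cong[OF refl])
    fix p assume p: "p \<in> Pe"
    then have pp: "p permutes {..<m}" by (simp add: Pe_def)
    show "(\<Sum>x\<in>T. prodW W x ys) = (\<Sum>x\<in>T. prodW W x (permute_list p ys))"
    proof (rule sum.reindex_bij_witness[of _ "permute_list (inv p)" "permute_list p"])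
      fix x assume x: "x \<in> T"
      have ip: "inv p permutes {..<m}" using pp by (rule permutes_inv)
      show "permute_list (inv p) (permute_list p x) = x"
        using permute_list_compose[of "inv p" x p] ip pp lT[OF x] by (simp add: permutes_inv_o)
      show "permute_list p (permute_list (inv p) x) = x"
        using permute_list_compose[of p x "inv p"] ip pp lT[OF x] by (simp add: permutes_inv_o)
      show "permute_list p x \<in> T" "permute_list (inv p) x \<in> T"
        using x pp ip lT[OF x] by (auto simp: T_def permutes_in_image permutations_of_multiset_def)
      show "prodW W (permute_list p x) (permute_list p ys) = prodW W x ys"
        by (rule prodW_permute_both[OF pp lT[OF x] ys])
    qed
  qed
  also have "\<dots> = (\<Sum>x\<in>T. \<Sum>p\<in>Pe. prodW W x (permute_list p ys))" by (rule sum.swap)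
  also have "\<dots> = real (card T) * avg" using each by simp
  finally have avgT: "fact m * (\<Sum>x\<in>T. prodW W x ys) = real (card T) * avg" .
  have avg0: "0 \<le> avg" unfolding avg_def prodW_def by (intro sum_nonneg prod_nonneg) (simp add: W)
  \<comment> \<open>\<open>q\<close> is the i.i.d. probability of each single word of the type
    class, so this is a partial sum of the expanded product output law.\<close>
  have "q * (\<Sum>x\<in>T. prodW W x ys) = (\<Sum>x\<in>T. \<Prod>i<m. P (x ! i) * W (x ! i) (ys ! i))"
    unfolding sum_distrib_left
  proof (intro sum.cong refl)
    fix x assume x: "x \<in> T"
    have "q = (\<Prod>i<m. P (x ! i))"
      using prod_nth_eq_prod_power_count[of P x] lT[OF x] x
      by (simp add: q_def T_def permutations_of_multiset_def)
    then show "q * prodW W x ys = (\<Prod>i<m. P (x ! i) * W (x ! i) (ys ! i))"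
      using lT[OF x] by (simp add: prodW_def prod.distrib)
  qed
  also have "\<dots> \<le> (\<Sum>x\<in>{x. length x = m}. \<Prod>i<m. P (x ! i) * W (x ! i) (ys ! i))"
    using lT by (intro sum_mono2 finite_lists_length_eq_UNIV) (auto intro!: prod_nonneg simp: P0 W)
  also have "\<dots> = (\<Prod>i<m. \<Sum>x\<in>UNIV. P x * W x (ys ! i))"
    by (rule sum_lists_prod)
  finally have up: "q * (\<Sum>x\<in>T. prodW W x ys) \<le> (\<Prod>i<m. \<Sum>x\<in>UNIV. P x * W x (ys ! i))" .
  have "1 \<le> (1 + real m) ^ CARD('x) * (real (card T) * q)"
    using type_class_prob_ge[of A m] m lx by (simp add: T_def q_def Pa) (simp add: A_def)
  from mult_right_mono[OF this avg0] have "avg \<le> (1 + real m) ^ CARD('x) * (q * (real (card T) * avg))"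
    by (simp add: mult_ac)
  also have "\<dots> = fact m * (1 + real m) ^ CARD('x) * (q * (\<Sum>x\<in>T. prodW W x ys))"
    unfolding avgT[symmetric] by (simp only: mult_ac)
  also have "\<dots> \<le> fact m * (1 + real m) ^ CARD('x) * (\<Prod>i<m. \<Sum>x\<in>UNIV. P x * W x (ys ! i))"
    by (intro mult_left_mono up) simp
  finally show ?thesis by (simp add: avg_def Pe_def)
qed

subsection \<open>Maximal coding\<close>

text \<open>Feinstein's argument: if no codeword can be added, averaging over the codewords contradicts \<open>other\<close>.
  The union over the two receivers is the source of the factor 2.\<close>

lemma greedy_codebook:
  fixes wt :: "'c \<Rightarrow> 'w \<Rightarrow> real" and A :: "nat \<Rightarrow> 'c \<Rightarrow> 'w set"
  assumes fin: "finite C" "C \<noteq> {}" "finite \<Omega>"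
    and wt: "\<And>c w. c \<in> C \<Longrightarrow> w \<in> \<Omega> \<Longrightarrow> 0 \<le> wt c w"
    and own: "\<And>k c. k \<in> {1,2} \<Longrightarrow> c \<in> C \<Longrightarrow>
        (\<Sum>w\<in>\<Omega>. wt c w * of_bool (w \<notin> A k c)) \<le> \<alpha>"
    and other: "\<And>k c'. k \<in> {1,2} \<Longrightarrow> c' \<in> C \<Longrightarrow>
        (\<Sum>c\<in>C. \<Sum>w\<in>\<Omega>. wt c w * of_bool (w \<in> A k c')) \<le> real (card C) * \<beta>"
    and M: "2 * real M * \<beta> \<le> \<tau>" and \<beta>: "0 \<le> \<beta>"
  shows "N \<le> Suc M \<Longrightarrow> \<exists>c. (\<forall>j<N. c j \<in> C) \<and> (\<forall>j<N. \<forall>k\<in>{1,2}.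
     (\<Sum>w\<in>\<Omega>. wt (c j) w * of_bool (w \<notin> A k (c j)
          \<or> (\<exists>i<j. w \<in> A k (c i)))) \<le> \<alpha> + \<tau>)"
proof (induction N)
  case 0
  then show ?case by simp
next
  case (Suc N)
  then obtain c where c: "\<forall>j<N. c j \<in> C" and cerr: "\<forall>j<N. \<forall>k\<in>{1,2}.
     (\<Sum>w\<in>\<Omega>. wt (c j) w * of_bool (w \<notin> A k (c j)
          \<or> (\<exists>i<j. w \<in> A k (c i)))) \<le> \<alpha> + \<tau>" by auto
  define e where "e k d = (\<Sum>w\<in>\<Omega>. wt d w * of_bool (w \<notin> A k d
          \<or> (\<exists>i<N. w \<in> A k (c i))))" for k d
  define U where "U k d = (\<Sum>i<N. \<Sum>w\<in>\<Omega>. wt d w * of_bool (w \<in> A k (c i)))" for k d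
  have U0: "0 \<le> U k d" if "d \<in> C" for k d
    unfolding U_def by (intro sum_nonneg mult_nonneg_nonneg wt that) auto
  have "\<exists>d\<in>C. \<forall>k\<in>{1,2}. e k d \<le> \<alpha> + \<tau>"
  proof (rule ccontr)
    assume "\<not> ?thesis"
    then have bad: "\<exists>k\<in>{1,2}. \<alpha> + \<tau> < e k d" if "d \<in> C" for d using that by force
    \<comment> \<open>The share \<alpha> is spent on the own test, so at the failing receiver the
      excess \<tau> comes from earlier codewords. The receiver depends on \<open>d\<close>; adding
      the nonnegative term of the other one gives a single quantity that can be summed over all
      \<open>d\<close>.\<close>
    have lt: "\<tau> < U 1 d + U 2 d" if d: "d \<in> C" for d
    proof -
      from bad[OF d] obtain k where k: "k \<in> {1,2}" "\<alpha> + \<tau> < e k d" by blast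
      have "e k d \<le> (\<Sum>w\<in>\<Omega>. wt d w * of_bool (w \<notin> A k d)
          + (\<Sum>i<N. wt d w * of_bool (w \<in> A k (c i))))"
        unfolding e_def
      proof (intro sum_mono)
        fix w assume w: "w \<in> \<Omega>"
        have "of_bool (\<exists>i<N. w \<in> A k (c i)) \<le> (\<Sum>i<N. of_bool (w \<in> A k (c i)) :: real)"
        proof (cases "\<exists>i<N. w \<in> A k (c i)")
          case True
          then obtain i where i: "i < N" "w \<in> A k (c i)" by blast
          then show ?thesis
            using member_le_sum[of i "{..<N}" "\<lambda>i. of_bool (w \<in> A k (c i)) :: real"] by auto
        qed (simp add: sum_nonneg)
        then have "of_bool (w \<notin> A k d \<or> (\<exists>i<N. w \<in> A k (c i)))
            \<le> of_bool (w \<notin> A k d) + (\<Sum>i<N. of_bool (w \<in> A k (c i)) :: real)"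
          by (auto simp: of_bool_def intro: order_trans split: if_splits)
        from mult_left_mono[OF this wt[OF d w]]
        show "wt d w * of_bool (w \<notin> A k d \<or> (\<exists>i<N. w \<in> A k (c i)))
            \<le> wt d w * of_bool (w \<notin> A k d)
              + (\<Sum>i<N. wt d w * of_bool (w \<in> A k (c i)))"
          by (simp only: distrib_left sum_distrib_left)
      qed
      also have "\<dots> = (\<Sum>w\<in>\<Omega>. wt d w * of_bool (w \<notin> A k d)) + U k d"
        unfolding U_def sum.distrib by (subst (2) sum.swap) simp
      also have "\<dots> \<le> \<alpha> + U k d" using own[OF k(1) d] by simp
      finally have "\<tau> < U k d" using k(2) by simp
      then show ?thesis using k(1) U0[OF d, of 1] U0[OF d, of 2] by auto
    qed
    have up: "(\<Sum>d\<in>C. U k d) \<le> real (card C) * (real N * \<beta>)" if k: "k \<in> {1,2}" for k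
    proof -
      have "(\<Sum>d\<in>C. U k d) = (\<Sum>i<N. \<Sum>d\<in>C. \<Sum>w\<in>\<Omega>. wt d w * of_bool (w \<in> A k (c i)))"
        unfolding U_def by (rule sum.swap)
      also have "\<dots> \<le> (\<Sum>i<N. real (card C) * \<beta>)" by (intro sum_mono other k) (use c in auto)
      finally show ?thesis by (simp add: mult_ac)
    qed
    have "real (card C) * \<tau> < (\<Sum>d\<in>C. U 1 d + U 2 d)"
      using sum_strict_mono[OF fin(1,2), of "\<lambda>_. \<tau>"] lt by simp
    also have "\<dots> \<le> real (card C) * (2 * real N * \<beta>)"
      using up[of 1] up[of 2] by (simp add: sum.distrib algebra_simps)
    \<comment> \<open>A new codeword competes with its \<open>N\<close> predecessors only, and
      \<open>N \<le> M\<close>; hence \<open>M\<close> in the hypothesis yields \<open>Suc M\<close>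
      codewords.\<close>
    also have "\<dots> \<le> real (card C) * (2 * real M * \<beta>)"
      using Suc.prems \<beta> by (intro mult_left_mono mult_right_mono) auto
    also have "\<dots> \<le> real (card C) * \<tau>" by (intro mult_left_mono M) simp
    finally show False by simp
  qed
  then obtain d where d: "d \<in> C" "\<forall>k\<in>{1,2}. e k d \<le> \<alpha> + \<tau>" by blast
  define c' where "c' = c(N := d)"
  have c'i: "c' i = c i" if "i < N" for i using that by (simp add: c'_def)
  have c'N: "c' N = d" by (simp add: c'_def)
  have "(\<forall>j<Suc N. c' j \<in> C)" using c d(1) by (auto simp: c'_def)
  moreover have "\<forall>j<Suc N. \<forall>k\<in>{1,2}.
     (\<Sum>w\<in>\<Omega>. wt (c' j) w * of_bool (w \<notin> A k (c' j)
          \<or> (\<exists>i<j. w \<in> A k (c' i)))) \<le> \<alpha> + \<tau>"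
  proof (intro allI impI ballI)
    fix j k assume j: "j < Suc N" and k: "k \<in> {1,2::nat}"
    \<comment> \<open>Only earlier codewords enter the error of codeword \<open>j\<close>, so
      appending \<open>d\<close> leaves the old bounds intact.\<close>
    have ex: "(\<exists>i<j. w \<in> A k (c' i)) = (\<exists>i<j. w \<in> A k (c i))" for w
      by (intro ex_cong1 conj_cong refl) (use j c'i in simp)
    show "(\<Sum>w\<in>\<Omega>. wt (c' j) w * of_bool (w \<notin> A k (c' j)
          \<or> (\<exists>i<j. w \<in> A k (c' i)))) \<le> \<alpha> + \<tau>"
    proof (cases "j < N")
      case True
      then show ?thesis using cerr k unfolding ex by (simp only: c'i)
    next
      case False
      then have "j = N" using j by simp
      then show ?thesis using d(2) k unfolding ex e_def by (simp only: c'N)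
    qed
  qed
  ultimately show ?case by blast
qed

lemma prod_lessThan_add:
  fixes f :: "nat \<Rightarrow> 'a::comm_monoid_mult"
  shows "(\<Prod>i<a + b. f i) = (\<Prod>i<a. f i) * (\<Prod>i<b. f (a + i))"
  by (induction b) (simp_all add: mult.assoc)

lemma prod_lessThan_mult:
  fixes f :: "nat \<Rightarrow> 'a::comm_monoid_mult"
  shows "(\<Prod>i<a * b. f i) = (\<Prod>l<a. \<Prod>q<b. f (l * b + q))"
  by (induction a) (simp_all add: prod_lessThan_add add.commute[of b])

subsection \<open>Permuted feedback schemes\<close>

text \<open>Here \<open>v1\<close> and \<open>v2\<close> hold one received block per index, unlike
  the full arrays in \<open>yprefix\<close>. In a real transmission only the selected blocks are
  sent, and they suffice, because \<open>h\<close> looks at nothing else.\<close>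

function path_rec :: "(nat \<Rightarrow> 'x list \<Rightarrow> 'y list \<Rightarrow> 'y list \<Rightarrow> nat) \<Rightarrow> (nat \<Rightarrow> nat \<Rightarrow> 'x list) \<Rightarrow>
    (nat \<Rightarrow> 'y list) \<Rightarrow> (nat \<Rightarrow> 'y list) \<Rightarrow> nat \<Rightarrow> nat" where
  "path_rec h xx v1 v2 l = h l (concat (map (\<lambda>j. xx j (path_rec h xx v1 v2 j)) [1..<l]))
     (concat (map v1 [1..<l])) (concat (map v2 [1..<l]))"
  by pat_completeness auto
termination
  by (relation "Wellfounded.measure (\<lambda>(_, _, _, _, l). l)") auto

declare path_rec.simps [simp del]

text \<open>The choice for block \<open>l\<close> looks strictly into the past. This makes the later
  encoder a genuine feedback encoder and lets \<open>sum_\<mu>\<close> integrate out the last block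
  first.\<close>

lemma path_rec_causal:
  assumes "\<And>j. 1 \<le> j \<Longrightarrow> j < l \<Longrightarrow> v1 j = v1' j" "\<And>j. 1 \<le> j \<Longrightarrow> j < l \<Longrightarrow> v2 j = v2' j"
  shows "path_rec h xx v1 v2 l = path_rec h xx v1' v2' l"
  using assms
proof (induction l rule: less_induct)
  case (less l)
  have "map (\<lambda>j. xx j (path_rec h xx v1 v2 j)) [1..<l] = map (\<lambda>j. xx j (path_rec h xx v1' v2' j)) [1..<l]"
    by (auto intro!: arg_cong[of _ _ "xx _"] less)
  moreover have "map v1 [1..<l] = map v1' [1..<l]" "map v2 [1..<l] = map v2' [1..<l]"
    by (auto intro!: less)
  ultimately show ?case by (simp only: path_rec.simps[of h xx v1 v2 l] path_rec.simps[of h xx v1' v2' l])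
qed

lemma path_rec_unique:
  assumes "\<And>l. l \<in> {1..L} \<Longrightarrow>
      h l (xprefix xx l b) (concat (map v1 [1..<l])) (concat (map v2 [1..<l])) = b l"
  shows "l \<in> {1..L} \<Longrightarrow> path_rec h xx v1 v2 l = b l"
proof (induction l rule: less_induct)
  case (less l)
  have "map (\<lambda>j. xx j (path_rec h xx v1 v2 j)) [1..<l] = map (\<lambda>j. xx j (b j)) [1..<l]"
    using less.prems by (auto intro!: arg_cong[of _ _ "xx _"] less.IH)
  then show ?case using assms[OF less.prems] by (simp only: path_rec.simps[of h xx v1 v2 l] xprefix_def)
qed

lemma length_concat_blocks:
  assumes "\<And>j. 1 \<le> j \<Longrightarrow> j < l \<Longrightarrow> length (v j) = m"
  shows "length (concat (map v [1..<l])) = (l - 1) * m"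
proof -
  have "map length (map v [1..<l]) = map (\<lambda>_. m) [1..<l]" using assms by auto
  then have "sum_list (map length (map v [1..<l])) = sum_list (map (\<lambda>_. m) [1..<l])" by (rule arg_cong)
  then show ?thesis by (simp add: length_concat sum_list_triv)
qed

locale feedback_scheme =
  fixes W1 W2 :: "'x::finite \<Rightarrow> 'y::finite \<Rightarrow> real"
    and S L m :: nat
    and P :: "nat \<Rightarrow> 'x \<Rightarrow> real"
    and h :: "nat \<Rightarrow> 'x list \<Rightarrow> 'y list \<Rightarrow> 'y list \<Rightarrow> nat"
    and xx :: "nat \<Rightarrow> nat \<Rightarrow> 'x list"
  assumes W1: "stochastic W1" and W2: "stochastic W2"
    and m: "m \<ge> 1"
    and h: "\<And>l xs ys1 ys2. \<lbrakk>l \<in> {1..L}; length xs = (l - 1) * m; length ys1 = (l - 1) * m;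
              length ys2 = (l - 1) * m\<rbrakk> \<Longrightarrow> h l xs ys1 ys2 \<in> {1..S}"
    and xx: "in_F S L m P xx"
begin

text \<open>A codeword is a tuple \<open>\<pi>\<close> of permutations, one per block: in block \<open>l\<close> the encoder sends the
  word \<open>xx l (b l)\<close> permuted by \<open>\<pi> l\<close>, and \<open>unpermute \<pi>\<close> undoes this permutation on the received blocks.
  After this correction the law \<open>\<mu>\<close> of the pair of outputs does not depend on \<open>\<pi>\<close>: the path \<open>b\<close>
  chosen by \<open>h\<close> is computed from the corrected outputs. Here \<open>w k b\<close> is the output law of receiver
  \<open>k\<close> along a fixed path, \<open>Q k b\<close> its memoryless counterpart, and \<open>G k\<close> the output law under
  uniformly random \<open>\<pi>\<close>.\<close>

definition channel :: "nat \<Rightarrow> 'x \<Rightarrow> 'y \<Rightarrow> real" where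
  "channel k = (if k = 1 then W1 else W2)"

definition sel :: "nat \<Rightarrow> 'a \<times> 'a \<Rightarrow> 'a" where
  "sel k \<omega> = (if k = 1 then fst \<omega> else snd \<omega>)"

definition V :: "(nat \<Rightarrow> 'y list) set" where
  "V = PiE {1..L} (\<lambda>_. {ys. length ys = m})"

definition path_of :: "(nat \<Rightarrow> 'y list) \<times> (nat \<Rightarrow> 'y list) \<Rightarrow> nat \<Rightarrow> nat" where
  "path_of \<omega> = restrict (path_rec h xx (fst \<omega>) (snd \<omega>)) {1..L}"

definition w :: "nat \<Rightarrow> (nat \<Rightarrow> nat) \<Rightarrow> (nat \<Rightarrow> 'y list) \<Rightarrow> real" where
  "w k b v = (\<Prod>l\<in>{1..L}. prodW (channel k) (xx l (b l)) (v l))"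

definition \<mu> :: "(nat \<Rightarrow> 'y list) \<times> (nat \<Rightarrow> 'y list) \<Rightarrow> real" where
  "\<mu> \<omega> = w 1 (path_of \<omega>) (fst \<omega>) * w 2 (path_of \<omega>) (snd \<omega>)"

definition Q :: "nat \<Rightarrow> (nat \<Rightarrow> nat) \<Rightarrow> (nat \<Rightarrow> 'y list) \<Rightarrow> real" where
  "Q k b v = (\<Prod>l\<in>{1..L}. \<Prod>i<m. \<Sum>x\<in>UNIV. P (b l) x * channel k x (v l ! i))"

lemma channel_stochastic: "stochastic (channel k)"
  using W1 W2 by (simp add: channel_def)

lemma channel_nonneg: "0 \<le> channel k x y"
  using channel_stochastic[of k] by (simp add: stochastic_def)

lemma xx_type: "l \<in> {1..L} \<Longrightarrow> s \<in> {1..S} \<Longrightarrow> has_type m (xx l s) (P s)"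
  using xx by (simp add: in_F_def)

lemma length_xx: "l \<in> {1..L} \<Longrightarrow> s \<in> {1..S} \<Longrightarrow> length (xx l s) = m"
  using xx_type by (auto simp: has_type_def)

lemma finite_V: "finite V"
  by (auto simp: V_def intro!: finite_PiE finite_lists_length_eq_UNIV)

lemma finite_B: "finite (Bspace S L)"
  by (auto simp: Bspace_def intro!: finite_PiE)

lemma length_V: "v \<in> V \<Longrightarrow> l \<in> {1..L} \<Longrightarrow> length (v l) = m"
  by (auto simp: V_def)

lemma w_nonneg: "0 \<le> w k b v"
  unfolding w_def by (intro prod_nonneg ballI prodW_nonneg channel_stochastic)

lemma \<mu>_nonneg: "0 \<le> \<mu> \<omega>"
  unfolding \<mu>_def by (intro mult_nonneg_nonneg w_nonneg)

text \<open>The range assumption on \<open>h\<close> covers only histories of the exact length, and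
  these lengths depend in turn on earlier choices lying in \<open>{1..S}\<close>; hence the strong
  induction.\<close>

lemma path_rec_range:
  assumes "\<And>j. j \<in> {1..<l} \<Longrightarrow> length (v1 j) = m" "\<And>j. j \<in> {1..<l} \<Longrightarrow> length (v2 j) = m"
  shows "l \<in> {1..L} \<Longrightarrow> path_rec h xx v1 v2 l \<in> {1..S}"
  using assms
proof (induction l rule: less_induct)
  case (less l)
  have "length (xx j (path_rec h xx v1 v2 j)) = m" if "1 \<le> j" "j < l" for j
    using that less.prems by (intro length_xx less.IH) auto
  then show ?case
    unfolding path_rec.simps[of h xx v1 v2 l] using less.prems
    by (intro h length_concat_blocks) auto
qed

lemma path_of_in_B: "\<omega> \<in> V \<times> V \<Longrightarrow> path_of \<omega> \<in> Bspace S L"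
  unfolding path_of_def Bspace_def
  by (intro restrict_PiE_iff[THEN iffD2] ballI path_rec_range) (auto simp: length_V)

text \<open>The constraints in \<open>joint_pmf\<close> fix the first choice, then the second, and
  so on, so a single path satisfies them. This collapses the sum over \<open>b\<close> in
  \<open>tail_prob\<close>.\<close>

lemma path_of_iff:
  assumes "b \<in> Bspace S L"
  shows "(\<forall>l\<in>{1..L}. h l (xprefix xx l b) (concat (map v1 [1..<l])) (concat (map v2 [1..<l])) = b l)
     \<longleftrightarrow> path_of (v1, v2) = b"
proof
  assume *: "\<forall>l\<in>{1..L}. h l (xprefix xx l b) (concat (map v1 [1..<l])) (concat (map v2 [1..<l])) = b l"
  have "path_rec h xx v1 v2 l = b l" if "l \<in> {1..L}" for l
    using path_rec_unique[of L h xx b v1 v2 l] * that by blast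
  then show "path_of (v1, v2) = b"
    using assms by (auto simp: path_of_def Bspace_def PiE_def extensional_def fun_eq_iff)
next
  assume b: "path_of (v1, v2) = b"
  show "\<forall>l\<in>{1..L}. h l (xprefix xx l b) (concat (map v1 [1..<l])) (concat (map v2 [1..<l])) = b l"
  proof
    fix l assume l: "l \<in> {1..L}"
    have "map (\<lambda>j. xx j (path_rec h xx v1 v2 j)) [1..<l] = map (\<lambda>j. xx j (b j)) [1..<l]"
      using l b by (auto simp: path_of_def)
    moreover have "b l = path_rec h xx v1 v2 l" using l b by (auto simp: path_of_def)
    ultimately show "h l (xprefix xx l b) (concat (map v1 [1..<l])) (concat (map v2 [1..<l])) = b l"
      by (simp only: path_rec.simps[of h xx v1 v2 l] xprefix_def)
  qed
qed

lemma sum_w: "b \<in> Bspace S L \<Longrightarrow> (\<Sum>v\<in>V. w k b v) = 1"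
  unfolding V_def w_def
  by (subst prod_sum_PiE[symmetric])
    (auto simp: finite_lists_length_eq_UNIV Bspace_def PiE_iff
      intro!: prod.neutral sum_prodW_eq_1[OF channel_stochastic length_xx])

lemma sum_PiE_atLeastAtMost_Suc:
  fixes f :: "(nat \<Rightarrow> 'b) \<Rightarrow> real"
  shows "(\<Sum>v\<in>PiE {1..Suc n} (\<lambda>_. A). f v) = (\<Sum>v\<in>PiE {1..n} (\<lambda>_. A). \<Sum>y\<in>A. f (v(Suc n := y)))"
proof -
  have ins: "{1..Suc n} = insert (Suc n) {1..n}" by auto
  have "(\<Sum>v\<in>PiE {1..Suc n} (\<lambda>_. A). f v) = (\<Sum>(y, v)\<in>A \<times> PiE {1..n} (\<lambda>_. A). f (v(Suc n := y)))"
    unfolding ins PiE_insert_eq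
    by (subst sum.reindex[OF inj_combinator]) (auto simp: case_prod_unfold)
  also have "\<dots> = (\<Sum>y\<in>A. \<Sum>v\<in>PiE {1..n} (\<lambda>_. A). f (v(Suc n := y)))"
    by (simp add: sum.cartesian_product)
  finally show ?thesis by (simp add: sum.swap[of _ A])
qed

text \<open>The sum does not factor over blocks, since inputs depend on outputs. By causality the
  last input word is fixed by the preceding blocks, so the last pair of blocks sums to 1 and
  induction applies.\<close>

lemma sum_\<mu>: "(\<Sum>\<omega>\<in>V \<times> V. \<mu> \<omega>) = 1"
proof -
  define X where "X n = PiE {1..n} (\<lambda>_. {ys :: 'y list. length ys = m})" for n :: nat
  define g where "g n v1 v2 = (\<Prod>l\<in>{1..n}. prodW W1 (xx l (path_rec h xx v1 v2 l)) (v1 l)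
      * prodW W2 (xx l (path_rec h xx v1 v2 l)) (v2 l))" for n v1 v2
  have "n \<le> L \<Longrightarrow> (\<Sum>v1\<in>X n. \<Sum>v2\<in>X n. g n v1 v2) = 1" for n
  proof (induction n)
    case 0
    then show ?case by (simp add: X_def g_def)
  next
    case (Suc n)
    have ins: "{1..Suc n} = insert (Suc n) {1..n}" by auto
    define D where "D = {ys :: 'y list. length ys = m}"
    have step: "(\<Sum>y1\<in>D. \<Sum>y2\<in>D. g (Suc n) (v1(Suc n := y1)) (v2(Suc n := y2))) = g n v1 v2"
      if v: "v1 \<in> X n" "v2 \<in> X n" for v1 v2
    proof -
      define b where "b = path_rec h xx v1 v2 (Suc n)"
      have br: "path_rec h xx (v1(Suc n := y1)) (v2(Suc n := y2)) l = path_rec h xx v1 v2 l" if "l \<le> Suc n" for y1 y2 l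
        using that by (intro path_rec_causal) auto
      have "b \<in> {1..S}" unfolding b_def using v Suc.prems by (intro path_rec_range) (auto simp: X_def)
      then have lx: "length (xx (Suc n) b) = m" using Suc.prems by (intro length_xx) auto
      have "g (Suc n) (v1(Suc n := y1)) (v2(Suc n := y2))
          = g n v1 v2 * (prodW W1 (xx (Suc n) b) y1 * prodW W2 (xx (Suc n) b) y2)" for y1 y2
        unfolding g_def ins by (subst prod.insert) (auto simp: br b_def intro!: prod.cong)
      then show ?thesis
        using sum_prodW_eq_1[OF W1 lx] sum_prodW_eq_1[OF W2 lx]
        by (simp add: D_def sum_distrib_left[symmetric])
    qed
    have "(\<Sum>v1\<in>X (Suc n). \<Sum>v2\<in>X (Suc n). g (Suc n) v1 v2)
        = (\<Sum>v1\<in>X n. \<Sum>y1\<in>D. \<Sum>v2\<in>X n. \<Sum>y2\<in>D. g (Suc n) (v1(Suc n := y1)) (v2(Suc n := y2)))"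
      unfolding X_def D_def[symmetric] sum_PiE_atLeastAtMost_Suc ..
    also have "\<dots> = (\<Sum>v1\<in>X n. \<Sum>v2\<in>X n. g n v1 v2)"
      by (intro sum.cong refl) (subst sum.swap, simp add: step)
    finally show ?case using Suc by simp
  qed
  then have "(\<Sum>v1\<in>V. \<Sum>v2\<in>V. g L v1 v2) = 1" by (simp add: X_def V_def)
  moreover have "\<mu> (v1, v2) = g L v1 v2" for v1 v2
    unfolding \<mu>_def g_def w_def prod.distrib by (simp add: path_of_def channel_def)
  moreover have "(\<Sum>\<omega>\<in>V \<times> V. \<mu> \<omega>) = (\<Sum>v1\<in>V. \<Sum>v2\<in>V. \<mu> (v1, v2))"
    by (simp add: sum.cartesian_product)
  ultimately show ?thesis by simp
qed

text \<open>The blocks off the selected path \<open>b\<close> integrate to one.\<close>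

lemma sum_Yspace_path:
  assumes b: "b \<in> Bspace S L"
  shows "(\<Sum>yy\<in>Yspace S L m. (\<Prod>l\<in>{1..L}. \<Prod>s\<in>{1..S}. prodW (channel k) (xx l s) (yy (l, s)))
            * f (\<lambda>l\<in>{1..L}. yy (l, b l)))
     = (\<Sum>v\<in>V. w k b v * f v)"
proof -
  define path where "path yy = (\<lambda>l\<in>{1..L}. yy (l, b l))" for yy :: "nat \<times> nat \<Rightarrow> 'y list"
  define a where "a yy = (\<Prod>l\<in>{1..L}. \<Prod>s\<in>{1..S}. prodW (channel k) (xx l s) (yy (l, s)))" for yy
  have bS: "b l \<in> {1..S}" if "l \<in> {1..L}" for l using b that by (auto simp: Bspace_def)
  have finY: "finite (Yspace S L m :: (nat \<times> nat \<Rightarrow> 'y list) set)"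
    unfolding Yspace_def by (intro finite_PiE finite_cartesian_product finite_lists_length_eq_UNIV) auto
  have fib: "(\<Sum>yy\<in>{yy\<in>Yspace S L m. path yy = v}. a yy) = w k b v" if v: "v \<in> V" for v
  proof -
    \<comment> \<open>Each fibre of \<open>path\<close> is a box, pinned at the selected blocks and
      free elsewhere, so the sum over it factors.\<close>
    define D where "D = (\<lambda>(l, s). if s = b l then {v l} else {ys :: 'y list. length ys = m})"
    have eq: "{yy\<in>Yspace S L m. path yy = v} = PiE ({1..L} \<times> {1..S}) D"
    proof (intro set_eqI iffI)
      fix yy assume yy: "yy \<in> {yy\<in>Yspace S L m. path yy = v}"
      then have "yy (l, b l) = v l" if "l \<in> {1..L}" for l
        using that by (auto simp: path_def fun_eq_iff split: if_splits)
      then show "yy \<in> PiE ({1..L} \<times> {1..S}) D"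
        using yy by (auto simp: Yspace_def D_def PiE_iff)
    next
      fix yy assume yy: "yy \<in> PiE ({1..L} \<times> {1..S}) D"
      have "yy (l, s) \<in> D (l, s)" if "l \<in> {1..L}" "s \<in> {1..S}" for l s
        using PiE_mem[OF yy] that by blast
      then have 1: "yy (l, b l) = v l" if "l \<in> {1..L}" for l using that bS[OF that] by (force simp: D_def)
      then have "path yy = v" using v by (auto simp: path_def V_def fun_eq_iff PiE_def extensional_def)
      moreover have "yy \<in> Yspace S L m"
        using yy length_V[OF v] by (fastforce simp: Yspace_def D_def PiE_iff split: if_splits)
      ultimately show "yy \<in> {yy\<in>Yspace S L m. path yy = v}" by simp
    qed
    have "(\<Sum>yy\<in>PiE ({1..L} \<times> {1..S}) D. a yy)
        = (\<Sum>yy\<in>PiE ({1..L} \<times> {1..S}) D. \<Prod>z\<in>{1..L} \<times> {1..S}. prodW (channel k) (xx (fst z) (snd z)) (yy z))"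
      by (simp add: a_def prod.cartesian_product case_prod_unfold)
    also have "\<dots> = (\<Prod>z\<in>{1..L} \<times> {1..S}. \<Sum>y\<in>D z. prodW (channel k) (xx (fst z) (snd z)) y)"
      by (rule prod_sum_PiE[symmetric]) (auto simp: D_def finite_lists_length_eq_UNIV)
    also have "\<dots> = (\<Prod>l\<in>{1..L}. \<Prod>s\<in>{1..S}. \<Sum>y\<in>D (l, s). prodW (channel k) (xx l s) y)"
      by (simp add: prod.cartesian_product case_prod_unfold)
    also have "\<dots> = (\<Prod>l\<in>{1..L}. \<Prod>s\<in>{1..S}. if s = b l then prodW (channel k) (xx l (b l)) (v l) else 1)"
      by (intro prod.cong refl) (auto simp: D_def sum_prodW_eq_1[OF channel_stochastic length_xx])
    also have "\<dots> = w k b v"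
      unfolding w_def by (intro prod.cong refl) (use bS in \<open>simp add: prod.delta\<close>)
    finally show ?thesis unfolding eq .
  qed
  have "(\<Sum>yy\<in>Yspace S L m. a yy * f (path yy))
      = (\<Sum>v\<in>V. \<Sum>yy\<in>{yy\<in>Yspace S L m. path yy = v}. a yy * f (path yy))"
    by (rule sum.group[symmetric, OF finY finite_V])
      (use bS in \<open>auto simp: path_def V_def Yspace_def PiE_iff\<close>)
  also have "\<dots> = (\<Sum>v\<in>V. \<Sum>yy\<in>{yy\<in>Yspace S L m. path yy = v}. a yy * f v)"
    by (intro sum.cong refl) auto
  also have "\<dots> = (\<Sum>v\<in>V. w k b v * f v)"
    by (intro sum.cong refl) (simp add: fib flip: sum_distrib_right)
  finally show ?thesis by (simp add: a_def path_def)
qed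

definition path_idens :: "nat \<Rightarrow> (nat \<Rightarrow> nat) \<Rightarrow> (nat \<Rightarrow> 'y list) \<Rightarrow> real" where
  "path_idens k b v = (\<Sum>l\<in>{1..L}. \<Sum>i<m. idens (P (b l)) (channel k) (xx l (b l) ! i) (v l ! i))"

text \<open>For fixed \<open>b\<close> both the selection indicator and the information density
  depend on the selected blocks alone. The law on full arrays thus reduces to the law
  \<open>\<mu>\<close> of an actual transmission of \<open>L\<close> blocks.\<close>

lemma tail_prob_eq:
  assumes k: "k \<in> {1, 2}"
  shows "tail_prob W1 W2 S L m P h xx k \<gamma> =
    (\<Sum>\<omega>\<in>V \<times> V. \<mu> \<omega> * of_bool (path_idens k (path_of \<omega>) (sel k \<omega>) \<le> \<gamma>))"
proof -
  define Y where "Y = (Yspace S L m :: (nat \<times> nat \<Rightarrow> 'y list) set)"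
  define a where "a k yy = (\<Prod>l\<in>{1..L}. \<Prod>s\<in>{1..S}. prodW (channel k) (xx l s) (yy (l, s)))" for k yy
  define path where "path b yy = (\<lambda>l\<in>{1..L}. yy (l, b l))" for b and yy :: "nat \<times> nat \<Rightarrow> 'y list"
  define F where "F b v1 v2 = of_bool (path_of (v1, v2) = b) * of_bool (path_idens k b (sel k (v1, v2)) \<le> \<gamma>) * (1::real)"
    for b v1 v2
  have summand: "joint_pmf W1 W2 S L h xx yy1 yy2 b *
        (if (if k = 1 then idens_total L m P W1 xx yy1 b else idens_total L m P W2 xx yy2 b) \<le> \<gamma>
         then 1 else 0) = a 1 yy1 * (a 2 yy2 * F b (path b yy1) (path b yy2))"
    if b: "b \<in> Bspace S L" for yy1 yy2 b
  proof -
    have pre: "yprefix yy l b = concat (map (path b yy) [1..<l])" if "l \<in> {1..L}" for yy :: "nat \<times> nat \<Rightarrow> 'y list" and l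
      unfolding yprefix_def path_def using that by (intro arg_cong[of _ _ concat]) auto
    have "(\<Prod>l\<in>{1..L}. if h l (xprefix xx l b) (yprefix yy1 l b) (yprefix yy2 l b) = b l then 1 else (0::real))
        = of_bool (\<forall>l\<in>{1..L}. h l (xprefix xx l b) (yprefix yy1 l b) (yprefix yy2 l b) = b l)"
      by (auto simp: prod_zero_iff)
    also have "\<dots> = of_bool (path_of (path b yy1, path b yy2) = b)"
      using path_of_iff[OF b, of "path b yy1" "path b yy2"] by (simp add: pre)
    finally have "joint_pmf W1 W2 S L h xx yy1 yy2 b
        = a 1 yy1 * a 2 yy2 * of_bool (path_of (path b yy1, path b yy2) = b)"
      unfolding joint_pmf_def prod.distrib by (simp add: a_def channel_def)
    moreover have "(if k = 1 then idens_total L m P W1 xx yy1 b else idens_total L m P W2 xx yy2 b)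
        = path_idens k b (sel k (path b yy1, path b yy2))"
      by (auto simp: idens_total_def path_idens_def sel_def path_def channel_def)
    ultimately show ?thesis by (simp add: F_def)
  qed
  have "tail_prob W1 W2 S L m P h xx k \<gamma>
      = (\<Sum>yy1\<in>Y. \<Sum>yy2\<in>Y. \<Sum>b\<in>Bspace S L. a 1 yy1 * (a 2 yy2 * F b (path b yy1) (path b yy2)))"
    unfolding tail_prob_def Y_def by (intro sum.cong refl summand)
  also have "\<dots> = (\<Sum>yy1\<in>Y. \<Sum>b\<in>Bspace S L. \<Sum>yy2\<in>Y. a 1 yy1 * (a 2 yy2 * F b (path b yy1) (path b yy2)))"
    by (intro sum.cong refl sum.swap)
  also have "\<dots> = (\<Sum>b\<in>Bspace S L. \<Sum>yy1\<in>Y. \<Sum>yy2\<in>Y. a 1 yy1 * (a 2 yy2 * F b (path b yy1) (path b yy2)))"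
    by (rule sum.swap)
  also have "\<dots> = (\<Sum>b\<in>Bspace S L. \<Sum>v1\<in>V. \<Sum>v2\<in>V. w 1 b v1 * (w 2 b v2 * F b v1 v2))"
  proof (intro sum.cong refl)
    fix b assume b: "b \<in> Bspace S L"
    have "(\<Sum>yy1\<in>Y. \<Sum>yy2\<in>Y. a 1 yy1 * (a 2 yy2 * F b (path b yy1) (path b yy2)))
        = (\<Sum>yy1\<in>Y. a 1 yy1 * (\<Sum>v2\<in>V. w 2 b v2 * F b (path b yy1) v2))"
      unfolding Y_def a_def path_def
      by (simp only: sum_distrib_left[symmetric] sum_Yspace_path[OF b, where f = "F b _"])
    also have "\<dots> = (\<Sum>v1\<in>V. w 1 b v1 * (\<Sum>v2\<in>V. w 2 b v2 * F b v1 v2))"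
      unfolding Y_def a_def path_def
      by (rule sum_Yspace_path[OF b])
    finally show "(\<Sum>yy1\<in>Y. \<Sum>yy2\<in>Y. a 1 yy1 * (a 2 yy2 * F b (path b yy1) (path b yy2)))
        = (\<Sum>v1\<in>V. \<Sum>v2\<in>V. w 1 b v1 * (w 2 b v2 * F b v1 v2))"
      by (simp add: sum_distrib_left)
  qed
  also have "\<dots> = (\<Sum>\<omega>\<in>V \<times> V. \<Sum>b\<in>Bspace S L. w 1 b (fst \<omega>) * (w 2 b (snd \<omega>) * F b (fst \<omega>) (snd \<omega>)))"
    by (simp add: sum.swap[of _ "V \<times> V"] sum.cartesian_product case_prod_unfold)
  also have "\<dots> = (\<Sum>\<omega>\<in>V \<times> V. \<mu> \<omega> * of_bool (path_idens k (path_of \<omega>) (sel k \<omega>) \<le> \<gamma>))"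
  proof (intro sum.cong refl)
    fix \<omega> assume \<omega>: "\<omega> \<in> V \<times> V"
    have "(\<Sum>b\<in>Bspace S L. w 1 b (fst \<omega>) * (w 2 b (snd \<omega>) * F b (fst \<omega>) (snd \<omega>)))
       = (\<Sum>b\<in>Bspace S L. if path_of \<omega> = b then \<mu> \<omega> * of_bool (path_idens k (path_of \<omega>) (sel k \<omega>) \<le> \<gamma>) else 0)"
      by (intro sum.cong refl) (auto simp: F_def \<mu>_def)
    then show "(\<Sum>b\<in>Bspace S L. w 1 b (fst \<omega>) * (w 2 b (snd \<omega>) * F b (fst \<omega>) (snd \<omega>)))
       = \<mu> \<omega> * of_bool (path_idens k (path_of \<omega>) (sel k \<omega>) \<le> \<gamma>)"
      using path_of_in_B[OF \<omega>] finite_B by simp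
  qed
  finally show ?thesis .
qed

section \<open>Likelihood ratios and information densities\<close>

text \<open>Each letter of \<open>xx l s\<close> has positive mass under the type of that word, so
  its own term already makes the output probability positive.\<close>

lemma PW_pos:
  assumes "l \<in> {1..L}" "s \<in> {1..S}" "i < m" "0 < channel k (xx l s ! i) y"
  shows "0 < (\<Sum>x\<in>UNIV. P s x * channel k x y)"
proof -
  have T: "has_type m (xx l s) (P s)" using assms by (intro xx_type)
  then have P: "P s a = real (count_list (xx l s) a) / real m" for a by (simp add: has_type_def)
  have "xx l s ! i \<in> set (xx l s)" using T assms by (simp add: has_type_def)
  then have "0 < P s (xx l s ! i)" using m P count_list_0_iff[of "xx l s" "xx l s ! i"] by simp
  moreover have "0 \<le> P s x" for x by (simp add: P)
  ultimately show ?thesis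
    using assms by (intro sum_pos2[of _ "xx l s ! i"]) (auto simp: channel_nonneg)
qed

text \<open>On outcomes with \<open>\<mu> \<noteq> 0\<close> every transition and output probability
  along the path is positive, so the exponential of \<open>path_idens\<close> is the ratio of
  \<open>w\<close> and \<open>Q\<close>. Where a transition probability vanishes,
  \<open>idens\<close> only has the default value of \<open>ln\<close> at 0, but such outcomes carry
  no mass.\<close>

lemma w_ratio_tail:
  assumes k: "k \<in> {1, 2}"
  shows "(\<Sum>\<omega>\<in>V \<times> V. \<mu> \<omega> * of_bool (w k (path_of \<omega>) (sel k \<omega>) \<le> exp \<gamma> * Q k (path_of \<omega>) (sel k \<omega>)))
     \<le> tail_prob W1 W2 S L m P h xx k \<gamma>"
  unfolding tail_prob_eq[OF k]
proof (intro sum_mono)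
  fix \<omega> assume \<omega>: "\<omega> \<in> V \<times> V"
  define b where "b = path_of \<omega>"
  define v where "v = sel k \<omega>"
  have "\<mu> \<omega> = 0 \<or> (w k b v \<le> exp \<gamma> * Q k b v \<longrightarrow> path_idens k b v \<le> \<gamma>)"
  proof (cases "\<mu> \<omega> = 0")
    case False
    then have "w k b v \<noteq> 0" using k by (auto simp: \<mu>_def b_def v_def sel_def)
    then have "prodW (channel k) (xx l (b l)) (v l) \<noteq> 0" if "l \<in> {1..L}" for l
      using that by (auto simp: w_def)
    moreover have bS: "b l \<in> {1..S}" if "l \<in> {1..L}" for l
      using path_of_in_B[OF \<omega>] that by (auto simp: b_def Bspace_def)
    ultimately have pos: "0 < channel k (xx l (b l) ! i) (v l ! i)" if "l \<in> {1..L}" "i < m" for l i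
      using that length_xx[of l "b l"] channel_nonneg[of k "xx l (b l) ! i" "v l ! i"]
      by (force simp: prodW_def less_le)
    have pos2: "0 < (\<Sum>x\<in>UNIV. P (b l) x * channel k x (v l ! i))" if "l \<in> {1..L}" "i < m" for l i
      using that by (intro PW_pos[of l "b l" i] bS pos)
    have weq: "w k b v = (\<Prod>l\<in>{1..L}. \<Prod>i<m. channel k (xx l (b l) ! i) (v l ! i))"
      unfolding w_def prodW_def using length_xx bS by (intro prod.cong refl) auto
    have "exp (path_idens k b v)
        = (\<Prod>l\<in>{1..L}. \<Prod>i<m. channel k (xx l (b l) ! i) (v l ! i) / (\<Sum>x\<in>UNIV. P (b l) x * channel k x (v l ! i)))"
      unfolding path_idens_def exp_sum[OF finite_atLeastAtMost] exp_sum[OF finite_lessThan] idens_def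
      by (intro prod.cong refl) (simp add: pos pos2)
    also have "\<dots> = w k b v / Q k b v" unfolding weq Q_def by (simp add: prod_dividef)
    finally have "exp (path_idens k b v) = w k b v / Q k b v" .
    moreover have "0 < Q k b v" unfolding Q_def by (intro prod_pos) (auto intro: pos2)
    ultimately have "w k b v = exp (path_idens k b v) * Q k b v" by simp
    then show ?thesis using \<open>0 < Q k b v\<close> by simp
  qed simp
  then show "\<mu> \<omega> * of_bool (w k (path_of \<omega>) (sel k \<omega>) \<le> exp \<gamma> * Q k (path_of \<omega>) (sel k \<omega>))
      \<le> \<mu> \<omega> * of_bool (path_idens k (path_of \<omega>) (sel k \<omega>) \<le> \<gamma>)"
    using \<mu>_nonneg[of \<omega>] by (auto simp: b_def v_def of_bool_def)
qed


section \<open>The group of block permutations and the averaged output law\<close>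

definition C :: "(nat \<Rightarrow> nat \<Rightarrow> nat) set" where
  "C = PiE {1..L} (\<lambda>_. {p. p permutes {..<m}})"

definition unpermute :: "(nat \<Rightarrow> nat \<Rightarrow> nat) \<Rightarrow> (nat \<Rightarrow> 'y list) \<Rightarrow> nat \<Rightarrow> 'y list" where
  "unpermute \<pi> r = (\<lambda>l\<in>{1..L}. permute_list (\<pi> l) (r l))"

definition unpermute2 :: "(nat \<Rightarrow> nat \<Rightarrow> nat) \<Rightarrow> (nat \<Rightarrow> 'y list) \<times> (nat \<Rightarrow> 'y list) \<Rightarrow>
    (nat \<Rightarrow> 'y list) \<times> (nat \<Rightarrow> 'y list)" where
  "unpermute2 \<pi> = map_prod (unpermute \<pi>) (unpermute \<pi>)"

text \<open>The joint law of output and path for a uniformly random codeword. It is kept separate by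
  path because only with the path fixed is the averaged output law dominated by a product
  law.\<close>

definition Gb :: "nat \<Rightarrow> (nat \<Rightarrow> 'y list) \<Rightarrow> (nat \<Rightarrow> nat) \<Rightarrow> real" where
  "Gb k r b = (\<Sum>\<pi>\<in>C. \<Sum>\<rho>\<in>V \<times> V.
      \<mu> (unpermute2 \<pi> \<rho>) * of_bool (sel k \<rho> = r \<and> path_of (unpermute2 \<pi> \<rho>) = b)) / real (card C)"

definition G :: "nat \<Rightarrow> (nat \<Rightarrow> 'y list) \<Rightarrow> real" where
  "G k r = (\<Sum>b\<in>Bspace S L. Gb k r b)"

lemma C_permutes: "\<pi> \<in> C \<Longrightarrow> l \<in> {1..L} \<Longrightarrow> \<pi> l permutes {..<m}"
  by (auto simp: C_def)

lemma finite_C: "finite C"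
  by (auto simp: C_def intro!: finite_PiE finite_permutations)

lemma card_C: "card C = fact m ^ L"
  by (simp add: C_def card_PiE card_permutations)

lemma card_C_pos: "0 < real (card C)"
  by (simp add: card_C)

lemma C_nonempty: "C \<noteq> {}"
  using card_C_pos by auto

lemma unpermute_in_V: "r \<in> V \<Longrightarrow> unpermute \<pi> r \<in> V"
  by (auto simp: unpermute_def V_def)

lemma unpermute_inverse:
  assumes "\<pi> \<in> C" "r \<in> V"
  shows "unpermute (\<lambda>l. inv (\<pi> l)) (unpermute \<pi> r) = r" "unpermute \<pi> (unpermute (\<lambda>l. inv (\<pi> l)) r) = r"
proof -
  have *: "permute_list (inv (\<pi> l)) (permute_list (\<pi> l) (r l)) = r l"
    "permute_list (\<pi> l) (permute_list (inv (\<pi> l)) (r l)) = r l" if l: "l \<in> {1..L}" for l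
    using permute_list_compose[of "inv (\<pi> l)" "r l" "\<pi> l"] permute_list_compose[of "\<pi> l" "r l" "inv (\<pi> l)"]
      C_permutes[OF assms(1) l] length_V[OF assms(2) l]
    by (simp_all add: permutes_inv permutes_inv_o)
  have "r l = undefined" if "l \<notin> {1..L}" for l using assms(2) that by (auto simp: V_def)
  then show "unpermute (\<lambda>l. inv (\<pi> l)) (unpermute \<pi> r) = r" "unpermute \<pi> (unpermute (\<lambda>l. inv (\<pi> l)) r) = r"
    using * by (auto simp: unpermute_def fun_eq_iff)
qed

lemma bij_unpermute: "\<pi> \<in> C \<Longrightarrow> bij_betw (unpermute \<pi>) V V"
  by (rule bij_betwI[where g = "unpermute (\<lambda>l. inv (\<pi> l))"]) (auto simp: unpermute_in_V unpermute_inverse)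

lemma bij_unpermute2: "\<pi> \<in> C \<Longrightarrow> bij_betw (unpermute2 \<pi>) (V \<times> V) (V \<times> V)"
  unfolding unpermute2_def by (intro bij_betw_map_prod bij_unpermute)

lemma unpermute2_in: "\<rho> \<in> V \<times> V \<Longrightarrow> unpermute2 \<pi> \<rho> \<in> V \<times> V"
  by (auto simp: unpermute2_def unpermute_in_V)

lemma sel_unpermute2: "sel k (unpermute2 \<pi> \<rho>) = unpermute \<pi> (sel k \<rho>)"
  by (simp add: sel_def unpermute2_def)

lemma sel_in_V: "\<rho> \<in> V \<times> V \<Longrightarrow> sel k \<rho> \<in> V"
  by (auto simp: sel_def)

lemma sum_unpermute: "\<pi> \<in> C \<Longrightarrow> (\<Sum>r\<in>V. f (unpermute \<pi> r)) = (\<Sum>v\<in>V. f v)"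
  by (rule sum.reindex_bij_betw[OF bij_unpermute])

lemma sum_unpermute2: "\<pi> \<in> C \<Longrightarrow> (\<Sum>\<rho>\<in>V \<times> V. f (unpermute2 \<pi> \<rho>)) = (\<Sum>\<omega>\<in>V \<times> V. f \<omega>)"
  by (rule sum.reindex_bij_betw[OF bij_unpermute2])

lemma unpermute_compose:
  assumes "\<pi> \<in> C" "r \<in> V"
  shows "unpermute \<pi> (unpermute q r) = unpermute (\<lambda>l\<in>{1..L}. q l \<circ> \<pi> l) r"
  using assms C_permutes[OF assms(1)] length_V[OF assms(2)]
  by (auto simp: unpermute_def fun_eq_iff permute_list_compose)

lemma unpermute2_compose:
  assumes "\<pi> \<in> C" "\<rho> \<in> V \<times> V"
  shows "unpermute2 \<pi> (unpermute2 q \<rho>) = unpermute2 (\<lambda>l\<in>{1..L}. q l \<circ> \<pi> l) \<rho>"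
  using assms unpermute_compose[OF assms(1), of _ q] by (auto simp: unpermute2_def)

lemma sum_C_compose:
  assumes q: "q \<in> C"
  shows "(\<Sum>\<pi>\<in>C. f (\<lambda>l\<in>{1..L}. q l \<circ> \<pi> l)) = (\<Sum>\<pi>\<in>C. f \<pi>)"
proof (rule sum.reindex_bij_witness[of _ "\<lambda>\<pi>. \<lambda>l\<in>{1..L}. inv (q l) \<circ> \<pi> l" "\<lambda>\<pi>. \<lambda>l\<in>{1..L}. q l \<circ> \<pi> l"])
  fix \<pi> assume \<pi>: "\<pi> \<in> C"
  have perm: "q l permutes {..<m}" "\<pi> l permutes {..<m}" if "l \<in> {1..L}" for l
    using C_permutes q \<pi> that by auto
  have und: "\<pi> l = undefined" if "l \<notin> {1..L}" for l using \<pi> that by (auto simp: C_def)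
  show "(\<lambda>l\<in>{1..L}. inv (q l) \<circ> (\<lambda>l\<in>{1..L}. q l \<circ> \<pi> l) l) = \<pi>"
    using und perm by (fastforce simp: fun_eq_iff permutes_inverses)
  show "(\<lambda>l\<in>{1..L}. q l \<circ> (\<lambda>l\<in>{1..L}. inv (q l) \<circ> \<pi> l) l) = \<pi>"
    using und perm by (fastforce simp: fun_eq_iff permutes_inverses)
  show "(\<lambda>l\<in>{1..L}. q l \<circ> \<pi> l) \<in> C" "(\<lambda>l\<in>{1..L}. inv (q l) \<circ> \<pi> l) \<in> C"
    unfolding C_def using perm by (auto intro!: permutes_compose permutes_inv)
qed simp

lemma Gb_nonneg: "0 \<le> Gb k r b"
  unfolding Gb_def by (intro divide_nonneg_nonneg sum_nonneg mult_nonneg_nonneg \<mu>_nonneg) auto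

lemma G_nonneg: "0 \<le> G k r"
  unfolding G_def by (intro sum_nonneg Gb_nonneg)

lemma sum_C_eq_sum_Gb:
  "(\<Sum>\<pi>\<in>C. \<Sum>\<rho>\<in>V \<times> V. \<mu> (unpermute2 \<pi> \<rho>) * f (sel k \<rho>) (path_of (unpermute2 \<pi> \<rho>)))
    = real (card C) * (\<Sum>r\<in>V. \<Sum>b\<in>Bspace S L. Gb k r b * f r b)"
proof -
  have one: "f (sel k \<rho>) (path_of (unpermute2 \<pi> \<rho>))
      = (\<Sum>r\<in>V. \<Sum>b\<in>Bspace S L. of_bool (sel k \<rho> = r \<and> path_of (unpermute2 \<pi> \<rho>) = b) * f r b)"
    if \<rho>: "\<rho> \<in> V \<times> V" for \<pi> \<rho>
  proof -
    have "(\<Sum>r\<in>V. \<Sum>b\<in>Bspace S L. of_bool (sel k \<rho> = r \<and> path_of (unpermute2 \<pi> \<rho>) = b) * f r b)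
      = (\<Sum>r\<in>V. if sel k \<rho> = r then (\<Sum>b\<in>Bspace S L. if path_of (unpermute2 \<pi> \<rho>) = b then f r b else 0) else 0)"
      by (intro sum.cong refl) (auto intro!: sum.cong)
    also have "\<dots> = f (sel k \<rho>) (path_of (unpermute2 \<pi> \<rho>))"
      using sel_in_V[OF \<rho>] path_of_in_B[OF unpermute2_in[OF \<rho>]] by (simp add: finite_V finite_B)
    finally show ?thesis by simp
  qed
  have "(\<Sum>\<pi>\<in>C. \<Sum>\<rho>\<in>V \<times> V. \<mu> (unpermute2 \<pi> \<rho>) * f (sel k \<rho>) (path_of (unpermute2 \<pi> \<rho>)))
    = (\<Sum>\<pi>\<in>C. \<Sum>\<rho>\<in>V \<times> V. \<Sum>r\<in>V. \<Sum>b\<in>Bspace S L.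
        \<mu> (unpermute2 \<pi> \<rho>) * of_bool (sel k \<rho> = r \<and> path_of (unpermute2 \<pi> \<rho>) = b) * f r b)"
    by (intro sum.cong refl, subst one) (auto simp: sum_distrib_left mult.assoc)
  also have "\<dots> = (\<Sum>\<pi>\<in>C. \<Sum>r\<in>V. \<Sum>b\<in>Bspace S L. \<Sum>\<rho>\<in>V \<times> V.
        \<mu> (unpermute2 \<pi> \<rho>) * of_bool (sel k \<rho> = r \<and> path_of (unpermute2 \<pi> \<rho>) = b) * f r b)"
    by (subst sum.swap[of _ V], subst sum.swap[of _ "Bspace S L"]) (rule refl)
  also have "\<dots> = (\<Sum>r\<in>V. \<Sum>b\<in>Bspace S L. \<Sum>\<pi>\<in>C. \<Sum>\<rho>\<in>V \<times> V.
        \<mu> (unpermute2 \<pi> \<rho>) * of_bool (sel k \<rho> = r \<and> path_of (unpermute2 \<pi> \<rho>) = b) * f r b)"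
    by (subst sum.swap[of _ V], subst sum.swap[of _ "Bspace S L"]) (rule refl)
  also have "\<dots> = (\<Sum>r\<in>V. \<Sum>b\<in>Bspace S L. real (card C) * (Gb k r b * f r b))"
    using card_C_pos by (intro sum.cong refl) (simp add: Gb_def sum_distrib_right)
  finally show ?thesis by (simp add: sum_distrib_left)
qed

lemma sum_G: "(\<Sum>r\<in>V. G k r) = 1"
proof -
  have "real (card C) * (\<Sum>r\<in>V. G k r) = (\<Sum>\<pi>\<in>C. \<Sum>\<rho>\<in>V \<times> V. \<mu> (unpermute2 \<pi> \<rho>) * 1)"
    by (subst sum_C_eq_sum_Gb[where k = k and f = "\<lambda>_ _. 1"]) (simp add: G_def)
  also have "\<dots> = real (card C)" by (simp add: sum_unpermute2 sum_\<mu>)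
  finally show ?thesis using card_C_pos by simp
qed

lemma G_eq:
  assumes "r \<in> V"
  shows "G k r = (\<Sum>\<pi>\<in>C. \<Sum>\<rho>\<in>V \<times> V. \<mu> (unpermute2 \<pi> \<rho>) * of_bool (sel k \<rho> = r)) / real (card C)"
proof -
  have "(\<Sum>r'\<in>V. \<Sum>b\<in>Bspace S L. Gb k r' b * of_bool (r' = r)) = G k r"
    using assms by (simp only: G_def sum_distrib_right[symmetric]) (simp add: finite_V)
  then show ?thesis
    using sum_C_eq_sum_Gb[where f = "\<lambda>r' _. of_bool (r' = r)"] card_C_pos by (simp add: field_simps)
qed

text \<open>A permutation of the output is absorbed into the uniformly random codeword, since
  composing with \<open>q\<close> is a bijection of \<open>C\<close>. Because of this invariance the
  error under the own test does not depend on the codeword.\<close>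

lemma G_unpermute:
  assumes q: "q \<in> C" and r: "r \<in> V"
  shows "G k (unpermute q r) = G k r"
proof -
  have "(\<Sum>\<rho>\<in>V \<times> V. \<mu> (unpermute2 \<pi> \<rho>) * of_bool (sel k \<rho> = unpermute q r))
      = (\<Sum>\<rho>\<in>V \<times> V. \<mu> (unpermute2 (\<lambda>l\<in>{1..L}. q l \<circ> \<pi> l) \<rho>) * of_bool (sel k \<rho> = r))"
    if \<pi>: "\<pi> \<in> C" for \<pi>
  proof -
    have "(\<Sum>\<rho>\<in>V \<times> V. \<mu> (unpermute2 \<pi> \<rho>) * of_bool (sel k \<rho> = unpermute q r))
      = (\<Sum>\<rho>\<in>V \<times> V. \<mu> (unpermute2 \<pi> (unpermute2 q \<rho>)) * of_bool (sel k (unpermute2 q \<rho>) = unpermute q r))"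
      by (rule sum_unpermute2[OF q, symmetric])
    also have "\<dots> = (\<Sum>\<rho>\<in>V \<times> V. \<mu> (unpermute2 (\<lambda>l\<in>{1..L}. q l \<circ> \<pi> l) \<rho>) * of_bool (sel k \<rho> = r))"
    proof (intro sum.cong refl)
      fix \<rho> assume \<rho>: "\<rho> \<in> V \<times> V"
      have "(unpermute q (sel k \<rho>) = unpermute q r) = (sel k \<rho> = r)"
        using inj_on_eq_iff[OF bij_betw_imp_inj_on[OF bij_unpermute[OF q]] sel_in_V[OF \<rho>] r] .
      then show "\<mu> (unpermute2 \<pi> (unpermute2 q \<rho>)) * of_bool (sel k (unpermute2 q \<rho>) = unpermute q r)
         = \<mu> (unpermute2 (\<lambda>l\<in>{1..L}. q l \<circ> \<pi> l) \<rho>) * of_bool (sel k \<rho> = r)"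
        by (simp only: unpermute2_compose[OF \<pi> \<rho>] sel_unpermute2)
    qed
    finally show ?thesis .
  qed
  then show ?thesis
    unfolding G_eq[OF r] G_eq[OF unpermute_in_V[OF r]]
    using sum_C_compose[OF q, of "\<lambda>\<pi>. \<Sum>\<rho>\<in>V \<times> V. \<mu> (unpermute2 \<pi> \<rho>) * of_bool (sel k \<rho> = r)"] by simp
qed

text \<open>Within a block all factors use the same distribution \<open>P (b l)\<close>, so only the
  multiset of received letters matters.\<close>

lemma Q_unpermute:
  assumes q: "q \<in> C" and r: "r \<in> V"
  shows "Q k b (unpermute q r) = Q k b r"
  unfolding Q_def
proof (rule prod.cong[OF refl])
  fix l assume l: "l \<in> {1..L}"
  define f where "f y = (\<Sum>x\<in>UNIV. P (b l) x * channel k x y)" for y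
  have ql: "q l permutes {..<m}" by (rule C_permutes[OF q l])
  have "(\<Prod>i<m. f (unpermute q r l ! i)) = (\<Prod>i<m. f (r l ! q l i))"
    using l ql length_V[OF r l] by (intro prod.cong refl) (simp add: unpermute_def permute_list_nth)
  also have "\<dots> = (\<Prod>i<m. f (r l ! i))"
    using prod.permute[OF ql, of "\<lambda>i. f (r l ! i)"] by (simp add: o_def)
  finally show "(\<Prod>i<m. \<Sum>x\<in>UNIV. P (b l) x * channel k x (unpermute q r l ! i))
      = (\<Prod>i<m. \<Sum>x\<in>UNIV. P (b l) x * channel k x (r l ! i))" by (simp add: f_def)
qed

text \<open>Once \<open>b\<close> is the path, dropping the event that it was chosen decouples the
  receivers, and the other output sums to 1. As \<open>C\<close> is a product, the average over
  permutations factors into blocks, each costing the factor of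
  \<open>sum_permutes_prodW_le\<close>.\<close>

lemma Gb_le:
  assumes k: "k \<in> {1, 2}" and r: "r \<in> V" and b: "b \<in> Bspace S L"
  shows "Gb k r b \<le> (1 + real m) ^ (L * CARD('x)) * Q k b r"
proof -
  have marg: "(\<Sum>\<rho>\<in>V \<times> V. \<mu> (unpermute2 \<pi> \<rho>) * of_bool (sel k \<rho> = r \<and> path_of (unpermute2 \<pi> \<rho>) = b)) \<le> w k b (unpermute \<pi> r)"
    if \<pi>: "\<pi> \<in> C" for \<pi>
  proof -
    have "(\<Sum>\<rho>\<in>V \<times> V. \<mu> (unpermute2 \<pi> \<rho>) * of_bool (sel k \<rho> = r \<and> path_of (unpermute2 \<pi> \<rho>) = b))
        \<le> (\<Sum>\<rho>\<in>V \<times> V. w 1 b (unpermute \<pi> (fst \<rho>)) * w 2 b (unpermute \<pi> (snd \<rho>)) * of_bool (sel k \<rho> = r))"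
      by (intro sum_mono) (auto simp: \<mu>_def unpermute2_def of_bool_def w_nonneg)
    also have "\<dots> = (\<Sum>r1\<in>V. \<Sum>r2\<in>V. w 1 b (unpermute \<pi> r1) * w 2 b (unpermute \<pi> r2) * of_bool (sel k (r1, r2) = r))"
      by (simp add: sum.cartesian_product case_prod_unfold)
    also have "\<dots> = w k b (unpermute \<pi> r)"
    proof (cases "k = 1")
      case True
      have "(\<Sum>r1\<in>V. \<Sum>r2\<in>V. w 1 b (unpermute \<pi> r1) * w 2 b (unpermute \<pi> r2) * of_bool (sel k (r1, r2) = r))
         = (\<Sum>r1\<in>V. if r1 = r then w 1 b (unpermute \<pi> r1) * (\<Sum>r2\<in>V. w 2 b (unpermute \<pi> r2)) else 0)"
        using True by (intro sum.cong refl) (auto simp: sel_def sum_distrib_left)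
      then show ?thesis using True r by (simp add: sum_unpermute[OF \<pi>] sum_w[OF b] finite_V)
    next
      case False
      then have k2: "k = 2" using k by simp
      have "(\<Sum>r1\<in>V. \<Sum>r2\<in>V. w 1 b (unpermute \<pi> r1) * w 2 b (unpermute \<pi> r2) * of_bool (sel k (r1, r2) = r))
         = (\<Sum>r2\<in>V. if r2 = r then w 2 b (unpermute \<pi> r2) * (\<Sum>r1\<in>V. w 1 b (unpermute \<pi> r1)) else 0)"
        using k2 by (subst sum.swap, intro sum.cong refl) (auto simp: sel_def sum_distrib_left mult.commute)
      then show ?thesis using k2 r by (simp add: sum_unpermute[OF \<pi>] sum_w[OF b] finite_V)
    qed
    finally show ?thesis .
  qed
  have "real (card C) * Gb k r b \<le> (\<Sum>\<pi>\<in>C. w k b (unpermute \<pi> r))"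
    unfolding Gb_def using card_C_pos marg by (simp add: sum_mono)
  also have "\<dots> = (\<Sum>\<pi>\<in>C. \<Prod>l\<in>{1..L}. prodW (channel k) (xx l (b l)) (permute_list (\<pi> l) (r l)))"
    by (simp add: w_def unpermute_def)
  also have "\<dots> = (\<Prod>l\<in>{1..L}. \<Sum>p\<in>{p. p permutes {..<m}}. prodW (channel k) (xx l (b l)) (permute_list p (r l)))"
    unfolding C_def by (rule prod_sum_PiE[symmetric]) (auto simp: finite_permutations)
  also have "\<dots> \<le> (\<Prod>l\<in>{1..L}. fact m * (1 + real m) ^ CARD('x) * (\<Prod>i<m. \<Sum>x\<in>UNIV. P (b l) x * channel k x (r l ! i)))"
  proof (intro prod_mono conjI sum_nonneg prodW_nonneg channel_stochastic sum_permutes_prodW_le channel_nonneg m)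
    fix l assume l: "l \<in> {1..L}"
    show "has_type m (xx l (b l)) (P (b l))" using b l by (intro xx_type) (auto simp: Bspace_def)
    show "length (r l) = m" using r l by (rule length_V)
  qed
  also have "\<dots> = real (card C) * ((1 + real m) ^ (L * CARD('x)) * Q k b r)"
    by (simp add: prod.distrib Q_def card_C power_mult power_mult_distrib mult.commute[of L])
  finally show ?thesis using card_C_pos by (simp only: mult_le_cancel_left_pos)
qed

lemma card_B: "real (card (Bspace S L)) = real S ^ L"
  by (simp add: Bspace_def card_PiE)

text \<open>The second error term is \<open>G\<close> exceeding \<open>Q\<close> by a large factor. Its probability does not depend
  on the permutation, so it may be averaged over all of them, where \<open>Gb \<le> (1 + m) ^ (L * |X|) * Q\<close>.\<close>

lemma own_test_bound:
  assumes k: "k \<in> {1, 2}" and S: "1 \<le> S" and \<pi>: "\<pi> \<in> C"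
    and \<theta>: "\<theta> = exp (\<gamma> - \<zeta>) / (real S ^ L * (1 + real m) ^ (L * CARD('x)))"
  shows "(\<Sum>\<rho>\<in>V \<times> V. \<mu> (unpermute2 \<pi> \<rho>)
        * of_bool (w k (path_of (unpermute2 \<pi> \<rho>)) (unpermute \<pi> (sel k \<rho>)) \<le> \<theta> * G k (sel k \<rho>)))
     \<le> tail_prob W1 W2 S L m P h xx k \<gamma> + exp (- \<zeta>)"
proof -
  define bad where "bad r b = (exp \<gamma> * Q k b r < \<theta> * G k r)" for r b
  define D where "D = (1 + real m) ^ (L * CARD('x))"
  have D: "0 < D" by (simp add: D_def)
  have inv: "(\<Sum>\<rho>\<in>V \<times> V. \<mu> (unpermute2 q \<rho>) * of_bool (bad (sel k \<rho>) (path_of (unpermute2 q \<rho>))))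
      = (\<Sum>\<omega>\<in>V \<times> V. \<mu> \<omega> * of_bool (bad (sel k \<omega>) (path_of \<omega>)))" if q: "q \<in> C" for q
  proof -
    have "(\<Sum>\<rho>\<in>V \<times> V. \<mu> (unpermute2 q \<rho>) * of_bool (bad (sel k \<rho>) (path_of (unpermute2 q \<rho>))))
       = (\<Sum>\<rho>\<in>V \<times> V. \<mu> (unpermute2 q \<rho>) * of_bool (bad (sel k (unpermute2 q \<rho>)) (path_of (unpermute2 q \<rho>))))"
      unfolding bad_def by (intro sum.cong refl) (simp add: sel_unpermute2 G_unpermute[OF q sel_in_V] Q_unpermute[OF q sel_in_V])
    then show ?thesis
      using sum_unpermute2[OF q, of "\<lambda>\<omega>. \<mu> \<omega> * of_bool (bad (sel k \<omega>) (path_of \<omega>))"] by simp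
  qed
  have "real (card C) * (\<Sum>\<omega>\<in>V \<times> V. \<mu> \<omega> * of_bool (bad (sel k \<omega>) (path_of \<omega>)))
      = (\<Sum>q\<in>C. \<Sum>\<rho>\<in>V \<times> V. \<mu> (unpermute2 q \<rho>) * of_bool (bad (sel k \<rho>) (path_of (unpermute2 q \<rho>))))"
    by (simp add: inv)
  also have "\<dots> = real (card C) * (\<Sum>r\<in>V. \<Sum>b\<in>Bspace S L. Gb k r b * of_bool (bad r b))"
    by (rule sum_C_eq_sum_Gb)
  finally have "(\<Sum>\<omega>\<in>V \<times> V. \<mu> \<omega> * of_bool (bad (sel k \<omega>) (path_of \<omega>)))
      = (\<Sum>r\<in>V. \<Sum>b\<in>Bspace S L. Gb k r b * of_bool (bad r b))"
    using card_C_pos by simp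
  also have "\<dots> \<le> (\<Sum>r\<in>V. \<Sum>b\<in>Bspace S L. D * (exp (- \<gamma>) * \<theta> * G k r))"
  proof (intro sum_mono)
    fix r b assume r: "r \<in> V" and b: "b \<in> Bspace S L"
    have \<theta>0: "0 \<le> \<theta>" by (simp add: \<theta>)
    show "Gb k r b * of_bool (bad r b) \<le> D * (exp (- \<gamma>) * \<theta> * G k r)"
    proof (cases "bad r b")
      case True
      then have "Q k b r \<le> exp (- \<gamma>) * \<theta> * G k r"
        unfolding bad_def by (simp add: exp_minus field_simps)
      then have "D * Q k b r \<le> D * (exp (- \<gamma>) * \<theta> * G k r)"
        using D by (intro mult_left_mono) auto
      with Gb_le[OF k r b] have "Gb k r b \<le> D * (exp (- \<gamma>) * \<theta> * G k r)"
        unfolding D_def by (rule order_trans)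
      then show ?thesis using True by simp
    next
      case False
      then show ?thesis using D \<theta>0 G_nonneg[of k r] by simp
    qed
  qed
  also have "\<dots> = D * exp (- \<gamma>) * \<theta> * real S ^ L * (\<Sum>r\<in>V. G k r)"
    by (simp add: sum_distrib_left card_B mult_ac)
  \<comment> \<open>The choice of \<theta>: its denominator cancels the number of paths and the type
    class factor \<open>D\<close>, its numerator leaves \<open>exp (- \<zeta>)\<close>.\<close>
  also have "\<dots> = exp (- \<zeta>)"
    using D S unfolding sum_G \<theta> D_def[symmetric] by (simp add: exp_diff exp_minus field_simps)
  finally have badle: "(\<Sum>\<omega>\<in>V \<times> V. \<mu> \<omega> * of_bool (bad (sel k \<omega>) (path_of \<omega>))) \<le> exp (- \<zeta>)" .
  have "(\<Sum>\<rho>\<in>V \<times> V. \<mu> (unpermute2 \<pi> \<rho>)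
        * of_bool (w k (path_of (unpermute2 \<pi> \<rho>)) (unpermute \<pi> (sel k \<rho>)) \<le> \<theta> * G k (sel k \<rho>)))
    = (\<Sum>\<rho>\<in>V \<times> V. \<mu> (unpermute2 \<pi> \<rho>)
        * of_bool (w k (path_of (unpermute2 \<pi> \<rho>)) (sel k (unpermute2 \<pi> \<rho>)) \<le> \<theta> * G k (sel k (unpermute2 \<pi> \<rho>))))"
    by (intro sum.cong refl) (simp add: sel_unpermute2 G_unpermute[OF \<pi> sel_in_V])
  also have "\<dots> = (\<Sum>\<omega>\<in>V \<times> V. \<mu> \<omega> * of_bool (w k (path_of \<omega>) (sel k \<omega>) \<le> \<theta> * G k (sel k \<omega>)))"
    by (rule sum_unpermute2[OF \<pi>, of "\<lambda>\<omega>. \<mu> \<omega> * of_bool (w k (path_of \<omega>) (sel k \<omega>) \<le> \<theta> * G k (sel k \<omega>))"])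
  \<comment> \<open>If \<open>w\<close> is at most \<theta> times \<open>G\<close>, then either it
    is at most \<open>exp \<gamma>\<close> times \<open>Q\<close>, or \<open>exp \<gamma>\<close>
    times \<open>Q\<close> lies below \<theta> times \<open>G\<close>.\<close>
  also have "\<dots> \<le> (\<Sum>\<omega>\<in>V \<times> V. \<mu> \<omega> * of_bool (w k (path_of \<omega>) (sel k \<omega>) \<le> exp \<gamma> * Q k (path_of \<omega>) (sel k \<omega>))
      + \<mu> \<omega> * of_bool (bad (sel k \<omega>) (path_of \<omega>)))"
    by (intro sum_mono) (auto simp: bad_def of_bool_def \<mu>_nonneg)
  also have "\<dots> \<le> tail_prob W1 W2 S L m P h xx k \<gamma> + exp (- \<zeta>)"
    unfolding sum.distrib by (intro add_mono w_ratio_tail[OF k] badle)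
  finally show ?thesis .
qed

text \<open>The receiver does not know the path and tests all \<open>S ^ L\<close> of them.\<close>

lemma other_test_bound:
  assumes \<pi>': "\<pi>' \<in> C" and \<theta>: "0 < \<theta>"
    and f: "\<And>r. f r \<Longrightarrow> \<exists>b'\<in>Bspace S L. \<theta> * G k r < w k b' (unpermute \<pi>' r)"
  shows "(\<Sum>\<pi>\<in>C. \<Sum>\<rho>\<in>V \<times> V. \<mu> (unpermute2 \<pi> \<rho>) * of_bool (f (sel k \<rho>)))
     \<le> real (card C) * (real S ^ L / \<theta>)"
proof -
  have "(\<Sum>r\<in>V. \<Sum>b\<in>Bspace S L. Gb k r b * of_bool (f r))
      \<le> (\<Sum>r\<in>V. \<Sum>b'\<in>Bspace S L. w k b' (unpermute \<pi>' r) / \<theta>)"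
  proof (rule sum_mono)
    fix r assume r: "r \<in> V"
    show "(\<Sum>b\<in>Bspace S L. Gb k r b * of_bool (f r)) \<le> (\<Sum>b'\<in>Bspace S L. w k b' (unpermute \<pi>' r) / \<theta>)"
    proof (cases "f r")
      case True
      then obtain b' where b': "b' \<in> Bspace S L" "\<theta> * G k r < w k b' (unpermute \<pi>' r)" using f by blast
      have "(\<Sum>b\<in>Bspace S L. Gb k r b * of_bool (f r)) \<le> G k r"
        unfolding G_def by (intro sum_mono) (simp add: Gb_nonneg of_bool_def)
      \<comment> \<open>Change of measure: on acceptance \<open>G\<close> is below a likelihood
        divided by \<theta>, and for each path the likelihoods add up to 1 over all outputs.\<close>
      also have "\<dots> \<le> w k b' (unpermute \<pi>' r) / \<theta>" using b' \<theta> by (simp add: field_simps)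
      also have "\<dots> \<le> (\<Sum>b'\<in>Bspace S L. w k b' (unpermute \<pi>' r) / \<theta>)"
        using b' \<theta> by (intro member_le_sum finite_B) (auto simp: w_nonneg)
      finally show ?thesis .
    next
      case False
      then show ?thesis using \<theta> by (auto intro!: sum_nonneg simp: w_nonneg)
    qed
  qed
  also have "\<dots> = (\<Sum>b'\<in>Bspace S L. (\<Sum>r\<in>V. w k b' (unpermute \<pi>' r)) / \<theta>)"
    by (subst sum.swap) (simp add: sum_divide_distrib)
  also have "\<dots> = real S ^ L / \<theta>"
    by (simp add: sum_unpermute[OF \<pi>'] sum_w card_B)
  finally show ?thesis
    unfolding sum_C_eq_sum_Gb[where k = k and f = "\<lambda>r _. of_bool (f r)"]
    by (rule mult_left_mono) simp
qed

subsection \<open>Encoder and decoder\<close>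

definition blocks_of :: "'y list \<Rightarrow> nat \<Rightarrow> 'y list" where
  "blocks_of y = (\<lambda>l\<in>{1..L}. take m (drop ((l - 1) * m) y))"

lemma block_index_less: "l < L \<Longrightarrow> q < m \<Longrightarrow> l * m + q < L * m"
proof -
  assume "l < L" "q < m"
  then have "l * m + q < Suc l * m" by simp
  also have "\<dots> \<le> L * m" using \<open>l < L\<close> by (intro mult_right_mono) auto
  finally show ?thesis .
qed

lemma bij_blocks:
  "bij_betw (\<lambda>y. (blocks_of y, drop (L * m) y)) {y. length y = L * m + nB} (V \<times> {t. length t = nB})"
proof (rule bij_betwI[where g = "\<lambda>(r, t). map (\<lambda>i. if i < L * m then r (Suc (i div m)) ! (i mod m)
      else t ! (i - L * m)) [0..<L * m + nB]"])
  show "(\<lambda>y. (blocks_of y, drop (L * m) y)) \<in> {y. length y = L * m + nB} \<rightarrow> V \<times> {t. length t = nB}"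
  proof
    fix y :: "'y list" assume y: "y \<in> {y. length y = L * m + nB}"
    have "(l - 1) * m + m \<le> L * m" if "l \<in> {1..L}" for l
    proof -
      have "(l - 1) * m + m = l * m" using that by (cases l) auto
      then show ?thesis using that by simp
    qed
    then have "length (take m (drop ((l - 1) * m) y)) = m" if "l \<in> {1..L}" for l
      using y that by (fastforce simp: min_absorb2)
    then show "(blocks_of y, drop (L * m) y) \<in> V \<times> {t. length t = nB}"
      using y by (simp add: blocks_of_def V_def)
  qed
next
  fix y :: "'y list" assume y: "y \<in> {y. length y = L * m + nB}"
  show "(case (blocks_of y, drop (L * m) y) of (r, t) \<Rightarrow> map (\<lambda>i. if i < L * m then r (Suc (i div m)) ! (i mod m)
      else t ! (i - L * m)) [0..<L * m + nB]) = y"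
  proof (rule nth_equalityI)
    fix i assume "i < length (case (blocks_of y, drop (L * m) y) of (r, t) \<Rightarrow> map (\<lambda>i. if i < L * m then r (Suc (i div m)) ! (i mod m)
      else t ! (i - L * m)) [0..<L * m + nB])"
    then have i: "i < L * m + nB" by simp
    have "i div m < L" if "i < L * m" using that m by (simp add: less_mult_imp_div_less)
    then show "(case (blocks_of y, drop (L * m) y) of (r, t) \<Rightarrow> map (\<lambda>i. if i < L * m then r (Suc (i div m)) ! (i mod m)
      else t ! (i - L * m)) [0..<L * m + nB]) ! i = y ! i"
      using i y m by (auto simp: blocks_of_def Suc_leI nth_drop[OF order_trans[OF div_times_less_eq_dividend]])
  qed (use y in auto)
next
  fix z assume z: "z \<in> V \<times> {t :: 'y list. length t = nB}"
  obtain r t where rt: "z = (r, t)" by (cases z)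
  define y where "y = map (\<lambda>i. if i < L * m then r (Suc (i div m)) ! (i mod m)
      else t ! (i - L * m)) [0..<L * m + nB]"
  have r: "r \<in> V" and t: "length t = nB" using z rt by auto
  have ynth: "y ! i = (if i < L * m then r (Suc (i div m)) ! (i mod m) else t ! (i - L * m))"
    if "i < L * m + nB" for i using that by (simp add: y_def)
  have "blocks_of y l = r l" for l
  proof (cases "l \<in> {1..L}")
    case True
    then obtain l' where l': "l = Suc l'" "l' < L" by (cases l) auto
    have le: "l' * m + m \<le> L * m" using l' by (metis Suc_leI add.commute mult_Suc mult_le_mono1)
    have "take m (drop (l' * m) y) = r l"
    proof (rule nth_equalityI)
      show "length (take m (drop (l' * m) y)) = length (r l)"
        using le length_V[OF r True] by (simp add: y_def)
      fix q assume "q < length (take m (drop (l' * m) y))"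
      then have q: "q < m" by simp
      have "l' * m + q < L * m" using q l' by (intro block_index_less)
      then show "take m (drop (l' * m) y) ! q = r l ! q"
        using q m by (simp add: ynth l' y_def)
    qed
    then show ?thesis using True l' by (simp add: blocks_of_def)
  next
    case False
    then show ?thesis using r by (auto simp: blocks_of_def V_def)
  qed
  moreover have "drop (L * m) y = t" using t by (intro nth_equalityI) (auto simp: y_def)
  ultimately show "(blocks_of (case z of (r, t) \<Rightarrow> map (\<lambda>i. if i < L * m then r (Suc (i div m)) ! (i mod m)
      else t ! (i - L * m)) [0..<L * m + nB]),
     drop (L * m) (case z of (r, t) \<Rightarrow> map (\<lambda>i. if i < L * m then r (Suc (i div m)) ! (i mod m)
      else t ! (i - L * m)) [0..<L * m + nB])) = z"
    unfolding rt prod.case y_def[symmetric] by auto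
qed auto

lemma sum_lists_blocks:
  "(\<Sum>y\<in>{y. length y = L * m + nB}. f (blocks_of y) (drop (L * m) y)) = (\<Sum>r\<in>V. \<Sum>t\<in>{t. length t = nB}. f r t)"
  using sum.reindex_bij_betw[OF bij_blocks, of "\<lambda>(r, t). f r t" nB] by (simp add: sum.cartesian_product)

text \<open>Time \<open>i\<close> counts from 1, blocks too. The inverse permutation on the letter
  index makes \<open>permute_list (\<pi> l)\<close> on the received block realign outputs with the
  letters of \<open>xx\<close>. The path is formally evaluated on blocks that may still be
  incomplete; \<open>path_of_take\<close> shows that they do not influence the current
  choice.\<close>

definition perm_encoder :: "(nat \<Rightarrow> nat \<Rightarrow> nat) \<Rightarrow> nat \<Rightarrow> 'y list \<Rightarrow> 'y list \<Rightarrow> 'x" where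
  "perm_encoder \<pi> i y1 y2 = (if i \<le> L * m
     then xx (Suc ((i - 1) div m)) (path_of (unpermute2 \<pi> (blocks_of y1, blocks_of y2)) (Suc ((i - 1) div m)))
            ! inv (\<pi> (Suc ((i - 1) div m))) ((i - 1) mod m)
     else undefined)"

lemma blocks_of_take:
  assumes "l \<in> {1..L}" "l * m \<le> n"
  shows "blocks_of (take n y) l = blocks_of y l"
proof -
  have "(l - 1) * m + m = l * m" using assms by (cases l) auto
  then have "m \<le> n - (l - 1) * m" using assms by simp
  then show ?thesis using assms(1) by (simp add: blocks_of_def drop_take min_absorb1)
qed

text \<open>The choice in block \<open>l\<close> needs only the blocks before \<open>l\<close>, and
  these are complete after \<open>(l - 1) * m\<close> channel uses.\<close>

lemma path_of_take:
  assumes "l \<in> {1..L}" "(l - 1) * m \<le> n"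
  shows "path_of (unpermute2 \<pi> (blocks_of (take n y1), blocks_of (take n y2))) l = path_of (unpermute2 \<pi> (blocks_of y1, blocks_of y2)) l"
proof -
  have *: "blocks_of (take n y) j = blocks_of y j" if "1 \<le> j" "j < l" for j and y :: "'y list"
  proof (rule blocks_of_take)
    show "j \<in> {1..L}" using that assms by auto
    have "j * m \<le> (l - 1) * m" using that by (intro mult_right_mono) auto
    also note assms(2)
    finally show "j * m \<le> n" .
  qed
  have "path_rec h xx (unpermute \<pi> (blocks_of (take n y1))) (unpermute \<pi> (blocks_of (take n y2))) l
      = path_rec h xx (unpermute \<pi> (blocks_of y1)) (unpermute \<pi> (blocks_of y2)) l"
    by (rule path_rec_causal) (simp_all add: unpermute_def *)
  then show ?thesis using assms by (simp add: path_of_def unpermute2_def)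
qed

lemma prod_block:
  assumes \<pi>: "\<pi> \<in> C" and l: "l < L" and y: "length y = L * m + nB" and x: "length x = m"
  shows "(\<Prod>q<m. W (x ! inv (\<pi> (Suc l)) q) (y ! (l * m + q))) = prodW W x (unpermute \<pi> (blocks_of y) (Suc l))"
proof -
  define p where "p = \<pi> (Suc l)"
  have p: "p permutes {..<m}" unfolding p_def using l by (intro C_permutes[OF \<pi>]) auto
  have le: "l * m + m \<le> L * m" using l by (metis Suc_leI add.commute mult_Suc mult_le_mono1)
  have lr: "length (blocks_of y (Suc l)) = m" using l le y by (simp add: blocks_of_def)
  have nth: "blocks_of y (Suc l) ! q = y ! (l * m + q)" if "q < m" for q
    using that l le y by (simp add: blocks_of_def)
  have "(\<Prod>q<m. W (x ! inv p q) (y ! (l * m + q))) = (\<Prod>q<m. W (x ! inv p (p q)) (y ! (l * m + p q)))"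
    using prod.permute[OF p, of "\<lambda>q. W (x ! inv p q) (y ! (l * m + q))"] by (simp add: o_def)
  also have "\<dots> = (\<Prod>q<m. W (x ! q) (permute_list p (blocks_of y (Suc l)) ! q))"
  proof (intro prod.cong refl)
    fix q assume "q \<in> {..<m}"
    then have "q < m" "p q < m" using permutes_in_image[OF p, of q] by auto
    then show "W (x ! inv p (p q)) (y ! (l * m + p q)) = W (x ! q) (permute_list p (blocks_of y (Suc l)) ! q)"
      using p lr by (simp add: permute_list_nth nth permutes_inverses)
  qed
  also have "\<dots> = prodW W x (unpermute \<pi> (blocks_of y) (Suc l))"
    using l x by (simp add: prodW_def unpermute_def p_def)
  finally show ?thesis by (simp add: p_def)
qed

lemma blocks_of_in_V: "length y = L * m + nB \<Longrightarrow> blocks_of y \<in> V"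
  using bij_betw_apply[OF bij_blocks, of y nB] by simp

lemma flf_prob_perm_encoder:
  assumes \<pi>: "\<pi> j \<in> C" and y1: "length y1 = L * m + nB" and y2: "length y2 = L * m + nB"
  shows "flf_prob W1 W2 (L * m + nB) (\<lambda>i j. perm_encoder (\<pi> j) i) j y1 y2 =
    \<mu> (unpermute2 (\<pi> j) (blocks_of y1, blocks_of y2))
     * (prodW W1 (replicate nB undefined) (drop (L * m) y1)
       * prodW W2 (replicate nB undefined) (drop (L * m) y2))"
proof -
  define \<rho> where "\<rho> = (blocks_of y1, blocks_of y2)"
  define b where "b = path_of (unpermute2 (\<pi> j) \<rho>)"
  define E where "E i = perm_encoder (\<pi> j) (Suc i) (take i y1) (take i y2)" for i
  have \<rho>: "\<rho> \<in> V \<times> V" using y1 y2 blocks_of_in_V by (simp add: \<rho>_def)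
  have b: "b \<in> Bspace S L" unfolding b_def by (intro path_of_in_B unpermute2_in \<rho>)
  \<comment> \<open>Every input is computed from a different truncated history; all of them agree
    with the one path \<open>b\<close> of the complete output, which is the path appearing in
    \<open>\<mu>\<close>.\<close>
  have E1: "E (l * m + q) = xx (Suc l) (b (Suc l)) ! inv (\<pi> j (Suc l)) q" if "l < L" "q < m" for l q
  proof -
    have "(l * m + q) div m = l" "(l * m + q) mod m = q" using that by auto
    moreover have "Suc (l * m + q) \<le> L * m" using block_index_less[OF that] by simp
    ultimately show ?thesis
      using that path_of_take[of "Suc l" "l * m + q" "\<pi> j" y1 y2] by (simp add: E_def perm_encoder_def b_def \<rho>_def)
  qed
  have E2: "E (L * m + q) = undefined" for q
    by (simp add: E_def perm_encoder_def)
  have lx: "length (xx (Suc l) (b (Suc l))) = m" if "l < L" for l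
    using that b by (intro length_xx) (auto simp: Bspace_def PiE_iff)
  have chan: "(\<Prod>i<L * m + nB. W (E i) (y ! i))
      = (\<Prod>l\<in>{1..L}. prodW W (xx l (b l)) (unpermute (\<pi> j) (blocks_of y) l)) * prodW W (replicate nB undefined) (drop (L * m) y)"
    if y: "length y = L * m + nB" for W y
  proof -
    have "(\<Prod>i<L * m. W (E i) (y ! i)) = (\<Prod>l<L. \<Prod>q<m. W (E (l * m + q)) (y ! (l * m + q)))"
      by (rule prod_lessThan_mult)
    also have "\<dots> = (\<Prod>l<L. prodW W (xx (Suc l) (b (Suc l))) (unpermute (\<pi> j) (blocks_of y) (Suc l)))"
    proof (intro prod.cong[OF refl])
      fix l assume "l \<in> {..<L}"
      then have l: "l < L" by simp
      have "(\<Prod>q<m. W (E (l * m + q)) (y ! (l * m + q)))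
          = (\<Prod>q<m. W (xx (Suc l) (b (Suc l)) ! inv (\<pi> j (Suc l)) q) (y ! (l * m + q)))"
        by (intro prod.cong refl) (simp add: E1 l)
      also have "\<dots> = prodW W (xx (Suc l) (b (Suc l))) (unpermute (\<pi> j) (blocks_of y) (Suc l))"
        by (rule prod_block[OF \<pi> l y lx[OF l]])
      finally show "(\<Prod>q<m. W (E (l * m + q)) (y ! (l * m + q)))
          = prodW W (xx (Suc l) (b (Suc l))) (unpermute (\<pi> j) (blocks_of y) (Suc l))" .
    qed
    also have "\<dots> = (\<Prod>l\<in>{1..L}. prodW W (xx l (b l)) (unpermute (\<pi> j) (blocks_of y) l))"
      by (simp add: prod.atLeast1_atMost_eq)
    finally show ?thesis
      using y by (simp add: prod_lessThan_add E2 prodW_def)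
  qed
  have "flf_prob W1 W2 (L * m + nB) (\<lambda>i j. perm_encoder (\<pi> j) i) j y1 y2
      = (\<Prod>i<L * m + nB. W1 (E i) (y1 ! i)) * (\<Prod>i<L * m + nB. W2 (E i) (y2 ! i))"
    unfolding flf_prob_def prod.distrib[symmetric] by (simp add: prod.atLeast1_atMost_eq E_def)
  also have "\<dots> = \<mu> (unpermute2 (\<pi> j) \<rho>) * (prodW W1 (replicate nB undefined) (drop (L * m) y1)
      * prodW W2 (replicate nB undefined) (drop (L * m) y2))"
    unfolding chan[OF y1] chan[OF y2] \<mu>_def w_def
    by (simp add: channel_def unpermute2_def \<rho>_def b_def mult_ac)
  finally show ?thesis by (simp add: \<rho>_def b_def)
qed

lemma sum_flf_prob_perm_encoder:
  assumes \<pi>: "\<pi> j \<in> C"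
  shows "(\<Sum>y1\<in>{y. length y = L * m + nB}. \<Sum>y2\<in>{y. length y = L * m + nB}.
      flf_prob W1 W2 (L * m + nB) (\<lambda>i j. perm_encoder (\<pi> j) i) j y1 y2 * f (blocks_of y1, blocks_of y2))
    = (\<Sum>\<rho>\<in>V \<times> V. \<mu> (unpermute2 (\<pi> j) \<rho>) * f \<rho>)"
proof -
  define T where "T = {t :: 'y list. length t = nB}"
  define p where "p W t = prodW W (replicate nB undefined) t" for W :: "'x \<Rightarrow> 'y \<Rightarrow> real" and t
  define F where "F r1 r2 = \<mu> (unpermute2 (\<pi> j) (r1, r2)) * f (r1, r2)" for r1 r2
  have one: "(\<Sum>t\<in>T. p W1 t) = 1" "(\<Sum>t\<in>T. p W2 t) = 1"
    unfolding T_def p_def by (intro sum_prodW_eq_1 W1 W2; simp)+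
  have "(\<Sum>y1\<in>{y. length y = L * m + nB}. \<Sum>y2\<in>{y. length y = L * m + nB}.
      flf_prob W1 W2 (L * m + nB) (\<lambda>i j. perm_encoder (\<pi> j) i) j y1 y2 * f (blocks_of y1, blocks_of y2))
    = (\<Sum>y1\<in>{y. length y = L * m + nB}. \<Sum>y2\<in>{y. length y = L * m + nB}.
        F (blocks_of y1) (blocks_of y2) * p W1 (drop (L * m) y1) * p W2 (drop (L * m) y2))"
    by (intro sum.cong refl) (simp add: flf_prob_perm_encoder[where \<pi> = \<pi>] \<pi> F_def p_def)
  also have "\<dots> = (\<Sum>y1\<in>{y. length y = L * m + nB}. \<Sum>r2\<in>V. \<Sum>t2\<in>T.
        F (blocks_of y1) r2 * p W1 (drop (L * m) y1) * p W2 t2)"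
    unfolding T_def by (intro sum.cong refl sum_lists_blocks)
  also have "\<dots> = (\<Sum>r1\<in>V. \<Sum>t1\<in>T. \<Sum>r2\<in>V. \<Sum>t2\<in>T. F r1 r2 * p W1 t1 * p W2 t2)"
    unfolding T_def by (rule sum_lists_blocks)
  also have "\<dots> = (\<Sum>r1\<in>V. (\<Sum>r2\<in>V. F r1 r2) * (\<Sum>t1\<in>T. p W1 t1))"
    by (simp only: sum_distrib_left[symmetric] one mult_1_right sum_distrib_right[symmetric])
  also have "\<dots> = (\<Sum>r1\<in>V. \<Sum>r2\<in>V. F r1 r2)" by (simp add: one)
  finally show ?thesis by (simp add: F_def sum.cartesian_product case_prod_unfold)
qed


text \<open>The condition involves \<open>M - 1\<close> because the last codeword has only that many
  predecessors to be confused with.\<close>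

lemma flf_code_exists:
  assumes S: "1 \<le> S" and M1: "1 \<le> M"
    and \<theta>: "\<theta> = exp (\<gamma> - \<zeta>) / (real S ^ L * (1 + real m) ^ (L * CARD('x)))"
    and tail: "\<And>k. k \<in> {1, 2} \<Longrightarrow> tail_prob W1 W2 S L m P h xx k \<gamma> + exp (- \<zeta>) \<le> \<alpha>"
    and M: "2 * real (M - 1) * (real S ^ L / \<theta>) \<le> \<tau>"
  shows "\<exists>q g1 g2. flf_code W1 W2 (L * m + nB) M (\<alpha> + \<tau>) q g1 g2"
proof -
  have \<theta>0: "0 < \<theta>" using S by (simp add: \<theta>)
  define D where "D k \<pi> = {r. \<exists>b\<in>Bspace S L. \<theta> * G k r < w k b (unpermute \<pi> r)}" for k \<pi>
  define A where "A k \<pi> = {\<rho>. sel k \<rho> \<in> D k \<pi>}" for k \<pi>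
  have "\<exists>c. (\<forall>j<M. c j \<in> C) \<and> (\<forall>j<M. \<forall>k\<in>{1,2}.
     (\<Sum>\<rho>\<in>V \<times> V. \<mu> (unpermute2 (c j) \<rho>) * of_bool (\<rho> \<notin> A k (c j) \<or> (\<exists>i<j. \<rho> \<in> A k (c i)))) \<le> \<alpha> + \<tau>)"
  proof (rule greedy_codebook[OF finite_C C_nonempty])
    show "finite (V \<times> V)" by (intro finite_cartesian_product finite_V)
    show "0 \<le> \<mu> (unpermute2 c \<rho>)" for c \<rho> by (rule \<mu>_nonneg)
    show "2 * real (M - 1) * (real S ^ L / \<theta>) \<le> \<tau>" by (rule M)
    show "0 \<le> real S ^ L / \<theta>" using \<theta>0 by simp
    show "M \<le> Suc (M - 1)" by simp
  next
    fix k c assume k: "k \<in> {1, 2::nat}" and c: "c \<in> C"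
    have "(\<Sum>\<rho>\<in>V \<times> V. \<mu> (unpermute2 c \<rho>) * of_bool (\<rho> \<notin> A k c))
       \<le> (\<Sum>\<rho>\<in>V \<times> V. \<mu> (unpermute2 c \<rho>)
        * of_bool (w k (path_of (unpermute2 c \<rho>)) (unpermute c (sel k \<rho>)) \<le> \<theta> * G k (sel k \<rho>)))"
    proof (intro sum_mono mult_left_mono \<mu>_nonneg)
      fix \<rho> assume "\<rho> \<in> V \<times> V"
      then have "path_of (unpermute2 c \<rho>) \<in> Bspace S L" by (intro path_of_in_B unpermute2_in)
      then show "(of_bool (\<rho> \<notin> A k c) :: real)
          \<le> of_bool (w k (path_of (unpermute2 c \<rho>)) (unpermute c (sel k \<rho>)) \<le> \<theta> * G k (sel k \<rho>))"
        by (auto simp: A_def D_def not_le)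
    qed
    also have "\<dots> \<le> tail_prob W1 W2 S L m P h xx k \<gamma> + exp (- \<zeta>)"
      by (rule own_test_bound[OF k S c \<theta>])
    also have "\<dots> \<le> \<alpha>" by (rule tail[OF k])
    finally show "(\<Sum>\<rho>\<in>V \<times> V. \<mu> (unpermute2 c \<rho>) * of_bool (\<rho> \<notin> A k c)) \<le> \<alpha>" .
  next
    fix k c' assume k: "k \<in> {1, 2::nat}" and c': "c' \<in> C"
    show "(\<Sum>c\<in>C. \<Sum>\<rho>\<in>V \<times> V. \<mu> (unpermute2 c \<rho>) * of_bool (\<rho> \<in> A k c'))
        \<le> real (card C) * (real S ^ L / \<theta>)"
      using other_test_bound[OF c' \<theta>0, where f = "\<lambda>r. r \<in> D k c'"] by (simp add: A_def D_def)
  qed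
  then obtain c where cC: "\<And>j. j < M \<Longrightarrow> c j \<in> C"
    and cerr: "\<And>j k. j < M \<Longrightarrow> k \<in> {1, 2} \<Longrightarrow> (\<Sum>\<rho>\<in>V \<times> V. \<mu> (unpermute2 (c j) \<rho>)
      * of_bool (\<rho> \<notin> A k (c j) \<or> (\<exists>i<j. \<rho> \<in> A k (c i)))) \<le> \<alpha> + \<tau>" by blast
  \<comment> \<open>Decode to the first accepting codeword; \<open>Suc\<close> shifts indices from 0
    to messages from 1. If nothing accepts, the value of \<open>LEAST\<close> is arbitrary, but that
    case is already counted as an error.\<close>
  define g where "g k r = Suc (LEAST i. r \<in> D k (c i))" for k r
  define enc where "enc = (\<lambda>i j. perm_encoder (c (j - 1)) i)"
  have msg: "(\<Sum>y1\<in>{y. length y = L * m + nB}. \<Sum>y2\<in>{y. length y = L * m + nB}.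
      flf_prob W1 W2 (L * m + nB) enc (Suc j) y1 y2
        * (if g k (blocks_of (if k = 1 then y1 else y2)) \<noteq> Suc j then 1 else 0)) \<le> \<alpha> + \<tau>"
    if k: "k \<in> {1, 2}" and j: "j < M" for k j
  proof -
    have err: "(of_bool (g k (sel k \<rho>) \<noteq> Suc j) :: real)
        \<le> of_bool (\<rho> \<notin> A k (c j) \<or> (\<exists>i<j. \<rho> \<in> A k (c i)))" for \<rho>
    proof (cases "\<rho> \<notin> A k (c j) \<or> (\<exists>i<j. \<rho> \<in> A k (c i))")
      case False
      then have "sel k \<rho> \<in> D k (c j)" "\<And>i. sel k \<rho> \<in> D k (c i) \<Longrightarrow> j \<le> i"
        by (auto simp: A_def not_less[symmetric])
      then have "(LEAST i. sel k \<rho> \<in> D k (c i)) = j" by (rule Least_equality)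
      then show ?thesis by (simp add: g_def)
    qed simp
    have "(\<Sum>y1\<in>{y. length y = L * m + nB}. \<Sum>y2\<in>{y. length y = L * m + nB}.
        flf_prob W1 W2 (L * m + nB) enc (Suc j) y1 y2
          * of_bool (g k (sel k (blocks_of y1, blocks_of y2)) \<noteq> Suc j))
      = (\<Sum>\<rho>\<in>V \<times> V. \<mu> (unpermute2 (c (Suc j - 1)) \<rho>) * of_bool (g k (sel k \<rho>) \<noteq> Suc j))"
      unfolding enc_def using cC[OF j]
      by (intro sum_flf_prob_perm_encoder[where \<pi> = "\<lambda>j. c (j - 1)"
            and f = "\<lambda>\<rho>. of_bool (g k (sel k \<rho>) \<noteq> Suc j)"]) simp
    also have "\<dots> \<le> (\<Sum>\<rho>\<in>V \<times> V. \<mu> (unpermute2 (c j) \<rho>)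
        * of_bool (\<rho> \<notin> A k (c j) \<or> (\<exists>i<j. \<rho> \<in> A k (c i))))"
      unfolding diff_Suc_1 by (intro sum_mono mult_left_mono err \<mu>_nonneg)
    also have "\<dots> \<le> \<alpha> + \<tau>" by (rule cerr[OF j k])
    finally show ?thesis
      unfolding sel_def fst_conv snd_conv of_bool_def if_distrib[of blocks_of] .
  qed
  have err: "flf_err W1 W2 (L * m + nB) M enc k (\<lambda>y. g k (blocks_of y)) \<le> \<alpha> + \<tau>" if k: "k \<in> {1, 2}" for k
  proof -
    have "real M * flf_err W1 W2 (L * m + nB) M enc k (\<lambda>y. g k (blocks_of y))
      = (\<Sum>j<M. \<Sum>y1\<in>{y. length y = L * m + nB}. \<Sum>y2\<in>{y. length y = L * m + nB}.
          flf_prob W1 W2 (L * m + nB) enc (Suc j) y1 y2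
            * (if g k (blocks_of (if k = 1 then y1 else y2)) \<noteq> Suc j then 1 else 0))"
      using M1 unfolding flf_err_def by (simp add: sum.atLeast1_atMost_eq)
    also have "\<dots> \<le> (\<Sum>j<M. \<alpha> + \<tau>)"
      by (intro sum_mono msg k) auto
    finally have "real M * flf_err W1 W2 (L * m + nB) M enc k (\<lambda>y. g k (blocks_of y)) \<le> real M * (\<alpha> + \<tau>)"
      by simp
    then show ?thesis using M1 by (simp add: mult_le_cancel_left_pos)
  qed
  have "flf_code W1 W2 (L * m + nB) M (\<alpha> + \<tau>) (return_pmf enc) (\<lambda>y. g 1 (blocks_of y)) (\<lambda>y. g 2 (blocks_of y))"
    using err[of 1] err[of 2] M1 by (simp add: flf_code_def)
  then show ?thesis by blast
qed

end

section \<open>Choice of the constants and conclusion\<close>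

lemma ln_ereal_ge:
  assumes "1 \<le> M" "ereal (real M) \<le> z"
  shows "ereal (ln (real M)) \<le> ln_ereal z"
  using assms by (cases z) (auto simp: ln_ereal_def)

lemma nf_err_nonneg: "stochastic W \<Longrightarrow> 0 \<le> nf_err W n M enc g"
  unfolding nf_err_def by (intro mult_nonneg_nonneg sum_nonneg prodW_nonneg) auto

text \<open>The infimum of an empty set of reals is unspecified, so a lower bound on
  \<open>eps_star\<close> requires a witness; a constant code provides one.\<close>

lemma nf_codes_nonempty:
  fixes W1 W2 :: "'x::finite \<Rightarrow> 'y::finite \<Rightarrow> real"
  shows "{e. \<exists>enc g1 g2. (\<forall>j\<in>{1..M}. length (enc j) = n) \<and>
       nf_err W1 n M enc g1 \<le> e \<and> nf_err W2 n M enc g2 \<le> e} \<noteq> {}"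
proof -
  define enc :: "nat \<Rightarrow> 'x list" where "enc = (\<lambda>_. replicate n undefined)"
  define g :: "'y list \<Rightarrow> nat" where "g = (\<lambda>_. 0)"
  have "(\<forall>j\<in>{1..M}. length (enc j) = n) \<and>
      nf_err W1 n M enc g \<le> max (nf_err W1 n M enc g) (nf_err W2 n M enc g) \<and>
      nf_err W2 n M enc g \<le> max (nf_err W1 n M enc g) (nf_err W2 n M enc g)" by (simp add: enc_def)
  then show ?thesis by blast
qed

text \<open>The constructed code has error at most \<open>eps\<close>; this turns it into a code for
  the larger error allowed in the theorem.\<close>

lemma eps_star_nonneg:
  assumes "stochastic W1"
  shows "0 \<le> eps_star W1 W2 n M"
  unfolding eps_star_def
  by (rule cInf_greatest[OF nf_codes_nonempty]) (use nf_err_nonneg[OF assms] order_trans in blast)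

text \<open>Together with \<open>2 \<le> 1 + m\<close> this pays for testing all paths.\<close>

lemma power_two_pred_ge: "1 \<le> S \<Longrightarrow> S \<le> 2 ^ (S - 1)" for S :: nat
  by (cases S) (auto simp: Suc_le_eq)

theorem theorem2:
  fixes W1 W2 :: "'x::finite \<Rightarrow> 'y::finite \<Rightarrow> real"
    and S L m nB :: nat
    and P :: "nat \<Rightarrow> 'x \<Rightarrow> real"
    and eps tau zeta :: real
    and h :: "nat \<Rightarrow> 'x list \<Rightarrow> 'y list \<Rightarrow> 'y list \<Rightarrow> nat"
    and xx :: "nat \<Rightarrow> nat \<Rightarrow> 'x list"
  assumes W1: "stochastic W1" and W2: "stochastic W2"
    and S: "S \<ge> 2" and L: "L \<ge> 1" and m: "m \<ge> 1" and nB: "nB \<ge> 1"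
    and P: "\<forall>s\<in>{1..S}. is_type m (P s)"
    and eps: "0 < eps" "eps < 1"
    and tau: "0 < tau" "tau < eps"
    and zeta: "zeta > 0"
    and h: "\<forall>l\<in>{1..L}. \<forall>xs ys1 ys2. length xs = (l - 1) * m \<and> length ys1 = (l - 1) * m
              \<and> length ys2 = (l - 1) * m \<longrightarrow> h l xs ys1 ys2 \<in> {1..S}"
    and xx: "in_F S L m P xx"
  shows "Sup {ereal \<gamma> | \<gamma>. max (tail_prob W1 W2 S L m P h xx 1 \<gamma>) (tail_prob W1 W2 S L m P h xx 2 \<gamma>)
                          < eps - tau - exp (- zeta)}
         + ereal (ln (tau / 2) - real S * real L * real CARD('x) * ln (1 + real m)
                  - real L * ln (real S) - zeta)
         \<le> ln_ereal (Mstar_f W1 W2 (L * m + nB) (eps + eps_star W1 W2 nB (S ^ L)))"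
proof -
  interpret feedback_scheme W1 W2 S L m P h xx
    by unfold_locales (use W1 W2 m h xx in auto)
  define c where "c = ln (tau / 2) - real S * real L * real CARD('x) * ln (1 + real m)
                  - real L * ln (real S) - zeta"
  define n where "n = L * m + nB"
  define E where "E = eps + eps_star W1 W2 nB (S ^ L)"
  have "ereal (\<gamma> + c) \<le> ln_ereal (Mstar_f W1 W2 n E)"
    if "max (tail_prob W1 W2 S L m P h xx 1 \<gamma>) (tail_prob W1 W2 S L m P h xx 2 \<gamma>) < eps - tau - exp (- zeta)"
    for \<gamma>
  proof -
    define \<alpha> where "\<alpha> = max (tail_prob W1 W2 S L m P h xx 1 \<gamma>) (tail_prob W1 W2 S L m P h xx 2 \<gamma>) + exp (- zeta)"
    \<comment> \<open>The error budget \<open>eps\<close> splits into the information density tail,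
      \<open>exp (- zeta)\<close> for \<open>G\<close> being too large, and \<open>tau\<close> for
      confusion with earlier codewords.\<close>
    have \<alpha>: "\<alpha> + tau \<le> E"
      using that eps_star_nonneg[OF W1, of W2 nB "S ^ L"] unfolding \<alpha>_def E_def by linarith
    define T where "T = exp (\<gamma> + c)"
    define K where "K = real S ^ L"
    define a where "a = (1 + real m)"
    define D where "D = a ^ (L * CARD('x))"
    define \<theta> where "\<theta> = exp (\<gamma> - zeta) / (real S ^ L * a ^ (L * CARD('x)))"
    have a: "2 \<le> a" using m by (simp add: a_def)
    have D0: "0 < D" and K0: "0 < K" using a S by (auto simp: D_def K_def)
    \<comment> \<open>Of the S equal shares of the exponent \<open>S * L * |X|\<close>, one is the
      type class factor \<open>D\<close>; the other \<open>S - 1\<close> are set aside for the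
      second factor \<open>K\<close>.\<close>
    have Teq: "T * (K * (D * a ^ ((S - 1) * (L * CARD('x))))) = tau / 2 * exp (\<gamma> - zeta)"
    proof -
      have "D * a ^ ((S - 1) * (L * CARD('x))) = a ^ (S * (L * CARD('x)))"
        using S by (cases S) (simp_all add: D_def power_add)
      also have "\<dots> = exp (real S * real L * real CARD('x) * ln a)"
        using a exp_of_nat_mult[of "S * (L * CARD('x))" "ln a"] by (simp add: mult.assoc)
      finally have "D * a ^ ((S - 1) * (L * CARD('x))) = exp (real S * real L * real CARD('x) * ln a)" .
      moreover have "K = exp (real L * ln (real S))" using S by (simp add: K_def exp_of_nat_mult)
      ultimately have "T * (K * (D * a ^ ((S - 1) * (L * CARD('x)))))
          = exp (\<gamma> + c + (real L * ln (real S) + real S * real L * real CARD('x) * ln a))"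
        by (simp only: T_def exp_add[symmetric])
      also have "\<dots> = exp (ln (tau / 2) + (\<gamma> - zeta))" by (simp add: c_def a_def)
      also have "\<dots> = tau / 2 * exp (\<gamma> - zeta)" unfolding exp_add using tau by simp
      finally show ?thesis .
    qed
    have big: "K \<le> a ^ ((S - 1) * (L * CARD('x)))"
    proof -
      have "real S \<le> real (2 ^ (S - 1))" using power_two_pred_ge[of S] S by (intro of_nat_mono) simp
      then have "real S ^ L \<le> (2 ^ (S - 1)) ^ L" by (intro power_mono) auto
      also have "\<dots> = (2::real) ^ ((S - 1) * L)" by (simp add: power_mult)
      also have "\<dots> \<le> 2 ^ ((S - 1) * (L * CARD('x)))" by (intro power_increasing mult_left_mono) auto
      also have "\<dots> \<le> a ^ ((S - 1) * (L * CARD('x)))" using a by (intro power_mono) auto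
      finally show ?thesis by (simp add: K_def)
    qed
    \<comment> \<open>Rounding up serves both ends: \<open>T \<le> M\<close> gives the lower bound
      on the logarithm, and \<open>M - 1 \<le> T\<close> the confusion bound.\<close>
    define M where "M = nat \<lceil>T\<rceil>"
    have T0: "0 < T" by (simp add: T_def)
    have M1: "1 \<le> M" using T0 by (simp add: M_def Suc_le_eq)
    have MT: "T \<le> real M" unfolding M_def by (rule real_nat_ceiling_ge)
    have "real M < T + 1" unfolding M_def using T0 by (simp add: of_nat_nat) linarith
    then have MT': "real (M - 1) \<le> T" using M1 by (simp add: of_nat_diff)
    have "2 * real (M - 1) * (K * (K * D)) \<le> 2 * T * (K * (K * D))"
      using MT' D0 K0 by (intro mult_right_mono) auto
    also have "\<dots> = 2 * T * (K * (D * K))" by (simp add: mult_ac)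
    also have "\<dots> \<le> 2 * T * (K * (D * a ^ ((S - 1) * (L * CARD('x)))))"
      using big T0 K0 D0 by (intro mult_left_mono) auto
    also have "\<dots> = tau * exp (\<gamma> - zeta)" using Teq by simp
    finally have "2 * real (M - 1) * (K * (K * D)) \<le> tau * exp (\<gamma> - zeta)" .
    moreover have "real S ^ L / \<theta> = K * (K * D) / exp (\<gamma> - zeta)"
      by (simp add: \<theta>_def K_def D_def)
    ultimately have small: "2 * real (M - 1) * (real S ^ L / \<theta>) \<le> tau" by (simp add: divide_le_eq)
    have "\<exists>q g1 g2. flf_code W1 W2 (L * m + nB) M (\<alpha> + tau) q g1 g2"
    proof (rule flf_code_exists[OF _ M1 \<theta>_def[unfolded a_def] _ small])
      show "1 \<le> S" using S by simp
      show "tail_prob W1 W2 S L m P h xx k \<gamma> + exp (- zeta) \<le> \<alpha>" if "k \<in> {1, 2}" for k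
        using that by (auto simp: \<alpha>_def)
    qed
    then have "\<exists>q g1 g2. flf_code W1 W2 n M E q g1 g2"
      unfolding n_def flf_code_def using \<alpha> order_trans by blast
    then have "ereal (real M) \<le> Mstar_f W1 W2 n E"
      unfolding Mstar_f_def by (intro Sup_upper) blast
    then have "ereal (ln (real M)) \<le> ln_ereal (Mstar_f W1 W2 n E)" by (rule ln_ereal_ge[OF M1])
    moreover have "\<gamma> + c \<le> ln (real M)" using MT M1 ln_ge_iff[of "real M" "\<gamma> + c"] by (simp add: T_def)
    ultimately show ?thesis by (meson ereal_less_eq(3) order_trans)
  qed
  \<comment> \<open>With the finite constant on the other side, a bound for each
    \<open>\<gamma>\<close> suffices; this includes the case of no admissible
    \<open>\<gamma>\<close>, where the supremum is minus infinity.\<close>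
  then have "Sup {ereal \<gamma> | \<gamma>. max (tail_prob W1 W2 S L m P h xx 1 \<gamma>) (tail_prob W1 W2 S L m P h xx 2 \<gamma>)
                          < eps - tau - exp (- zeta)} \<le> ln_ereal (Mstar_f W1 W2 n E) - ereal c"
    by (intro Sup_least) (auto simp: ereal_le_minus)
  then show ?thesis by (simp add: ereal_le_minus c_def n_def E_def)
qed

end
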